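(* There is a polynomial time $3$-approximation algorithm for the robust knapsack center problem.
   Context: Robust knapsack center problem: given a finite metric space $(X,d)$, a weight function $w:X\to\mathbb{R}_{\ge0}$, a budget $k\ge0$ and an integer $m\in\{0,\dots,|X|\}$, find $S\subseteq X$ with $w(S)=\sum_{v\in S}w(v)\le k$ minimizing $\min_{T\subseteq X,|T|=m}\max_{v\in T}d(v,S)$, where $d(v,S)=\min_{u\in S}d(v,u)$. Let $\mathrm{OPT}$ be the optimum value. A $3$-approximation returns $S$ with $w(S)\le k$ such that at least $m$ points $v\in X$ satisfy $d(v,S)\le 3\,\mathrm{OPT}$. The weights are arbitrary (not required to be polynomially bounded). *)

theory Defs
  imports "HOL-Analysis.Analysis" "HOL-Computational_Algebra.Polynomial"
begin

section \<open>The robust knapsack center problem\<close>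

text \<open>
  Distances to sets and objective values live in \<^typ>\<open>ennreal\<close>, so that the degenerate cases get
  their natural values: the distance to the empty set is infinite, and the maximum over
  the empty set of points (\<open>m = 0\<close>) is 0. On the finite nonempty sets that occur otherwise,
  the infima and suprema below are minima and maxima.
\<close>

definition set_dist :: "('a \<Rightarrow> 'a \<Rightarrow> real) \<Rightarrow> 'a \<Rightarrow> 'a set \<Rightarrow> ennreal" where
  "set_dist d v S = (INF u\<in>S. ennreal (d v u))"

definition rkc_instance ::
  "'a set \<Rightarrow> ('a \<Rightarrow> 'a \<Rightarrow> real) \<Rightarrow> ('a \<Rightarrow> real) \<Rightarrow> real \<Rightarrow> nat \<Rightarrow> bool" where
  "rkc_instance X d w k m \<longleftrightarrow>
     finite X \<and> Metric_space X d \<and> (\<forall>v\<in>X. 0 \<le> w v) \<and> 0 \<le> k \<and> m \<le> card X"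

definition rkc_feasible :: "'a set \<Rightarrow> ('a \<Rightarrow> real) \<Rightarrow> real \<Rightarrow> 'a set \<Rightarrow> bool" where
  "rkc_feasible X w k S \<longleftrightarrow> S \<subseteq> X \<and> (\<Sum>v\<in>S. w v) \<le> k"

definition rkc_cost :: "'a set \<Rightarrow> ('a \<Rightarrow> 'a \<Rightarrow> real) \<Rightarrow> nat \<Rightarrow> 'a set \<Rightarrow> ennreal" where
  "rkc_cost X d m S = (INF T\<in>{T. T \<subseteq> X \<and> card T = m}. SUP v\<in>T. set_dist d v S)"

definition rkc_opt ::
  "'a set \<Rightarrow> ('a \<Rightarrow> 'a \<Rightarrow> real) \<Rightarrow> ('a \<Rightarrow> real) \<Rightarrow> real \<Rightarrow> nat \<Rightarrow> ennreal" where
  "rkc_opt X d w k m = (INF S\<in>{S. rkc_feasible X w k S}. rkc_cost X d m S)"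

definition rkc_approx ::
  "ennreal \<Rightarrow> 'a set \<Rightarrow> ('a \<Rightarrow> 'a \<Rightarrow> real) \<Rightarrow> ('a \<Rightarrow> real) \<Rightarrow> real \<Rightarrow> nat \<Rightarrow> 'a set \<Rightarrow> bool" where
  "rkc_approx \<alpha> X d w k m S \<longleftrightarrow>
     rkc_feasible X w k S \<and> m \<le> card {v \<in> X. set_dist d v S \<le> \<alpha> * rkc_opt X d w k m}"


section \<open>Machine model\<close>

text \<open>
  Instances contain real numbers, so algorithms are programs of a real random access machine
  (real RAM): integer arrays for control and addressing, real arrays for numerical data, unit
  cost per executed command. Programs are finite syntax trees with integer constants only; in
  particular one program serves all instances, and real numbers enter through the input alone.

  The only arithmetic operations are addition, subtraction, comparison and the embedding of
  the integers into the reals; there is no multiplication, division or rounding of reals. Hence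
  after \<open>t\<close> steps every integer cell is bounded by \<open>C ^ t\<close> times the largest input integer plus 1,
  and every real cell is an integer linear combination of 1 and the input reals with
  coefficients bounded likewise (\<open>C\<close> depends on the program only). So on rational input in
  binary, \<open>t\<close> steps can be simulated by a Turing machine in time polynomial in \<open>t\<close> and the
  length of the input: unit cost hides no superpolynomial bit complexity, and a number of steps
  polynomial in the number of points implies polynomial time in the usual sense, whatever the
  magnitude of the weights and distances.

  A scalar variable is the cell with index 0 of an array.
\<close>

type_synonym arr = string

datatype iexp =
    IConst int
  | ICell arr iexp
  | IAdd iexp iexp
  | ISub iexp iexp

datatype rexp =
    ROf iexp
  | RCell arr iexp
  | RAdd rexp rexp
  | RSub rexp rexp

datatype bexp =
    ILess iexp iexp
  | RLess rexp rexp
  | BNot bexp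
  | BAnd bexp bexp

datatype com =
    Skip
  | IAssign arr iexp iexp
  | RAssign arr iexp rexp
  | Seq com com
  | If bexp com com
  | While bexp com

record state =
  ints :: "arr \<Rightarrow> int \<Rightarrow> int"
  reals :: "arr \<Rightarrow> int \<Rightarrow> real"

fun ival :: "iexp \<Rightarrow> state \<Rightarrow> int" where
  "ival (IConst c) s = c"
| "ival (ICell a e) s = ints s a (ival e s)"
| "ival (IAdd e1 e2) s = ival e1 s + ival e2 s"
| "ival (ISub e1 e2) s = ival e1 s - ival e2 s"

fun rval :: "rexp \<Rightarrow> state \<Rightarrow> real" where
  "rval (ROf e) s = of_int (ival e s)"
| "rval (RCell a e) s = reals s a (ival e s)"
| "rval (RAdd e1 e2) s = rval e1 s + rval e2 s"
| "rval (RSub e1 e2) s = rval e1 s - rval e2 s"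

fun bval :: "bexp \<Rightarrow> state \<Rightarrow> bool" where
  "bval (ILess e1 e2) s \<longleftrightarrow> ival e1 s < ival e2 s"
| "bval (RLess e1 e2) s \<longleftrightarrow> rval e1 s < rval e2 s"
| "bval (BNot b) s \<longleftrightarrow> \<not> bval b s"
| "bval (BAnd b1 b2) s \<longleftrightarrow> bval b1 s \<and> bval b2 s"

definition iupd :: "arr \<Rightarrow> int \<Rightarrow> int \<Rightarrow> state \<Rightarrow> state" where
  "iupd a i x s = s\<lparr>ints := (ints s)(a := (ints s a)(i := x))\<rparr>"

definition rupd :: "arr \<Rightarrow> int \<Rightarrow> real \<Rightarrow> state \<Rightarrow> state" where
  "rupd a i x s = s\<lparr>reals := (reals s)(a := (reals s a)(i := x))\<rparr>"

text \<open>
  \<open>exec c s t s'\<close>: started in \<open>s\<close>, program \<open>c\<close> halts after \<open>t\<close> steps in \<open>s'\<close>. Every assignment and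
  every evaluation of a guard is one step; the expressions of a program have constant size.
\<close>

inductive exec :: "com \<Rightarrow> state \<Rightarrow> nat \<Rightarrow> state \<Rightarrow> bool" where
  Skip: "exec Skip s 1 s"
| IAssign: "exec (IAssign a i e) s 1 (iupd a (ival i s) (ival e s) s)"
| RAssign: "exec (RAssign a i e) s 1 (rupd a (ival i s) (rval e s) s)"
| Seq: "exec c1 s t1 s' \<Longrightarrow> exec c2 s' t2 s'' \<Longrightarrow> exec (Seq c1 c2) s (t1 + t2) s''"
| IfTrue: "bval b s \<Longrightarrow> exec c1 s t s' \<Longrightarrow> exec (If b c1 c2) s (1 + t) s'"
| IfFalse: "\<not> bval b s \<Longrightarrow> exec c2 s t s' \<Longrightarrow> exec (If b c1 c2) s (1 + t) s'"
| WhileFalse: "\<not> bval b s \<Longrightarrow> exec (While b c) s 1 s"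
| WhileTrue: "bval b s \<Longrightarrow> exec c s t1 s' \<Longrightarrow> exec (While b c) s' t2 s'' \<Longrightarrow>
    exec (While b c) s (1 + t1 + t2) s''"

inductive_cases SkipE: "exec Skip s t s'"
  and IAssignE: "exec (IAssign a i e) s t s'"
  and RAssignE: "exec (RAssign a i e) s t s'"
  and SeqE: "exec (Seq c1 c2) s t s'"
  and IfE: "exec (If b c1 c2) s t s'"
  and WhileE: "exec (While b c) s t s'"

lemma exec_deterministic:
  "exec c s t s' \<Longrightarrow> exec c s u s'' \<Longrightarrow> u = t \<and> s'' = s'"
proof (induction arbitrary: u s'' rule: exec.induct)
  case (Skip s)
  from Skip show ?case by (rule SkipE) simp
next
  case (IAssign a i e s)
  from IAssign show ?case by (rule IAssignE) simp
next
  case (RAssign a i e s)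
  from RAssign show ?case by (rule RAssignE) simp
next
  case (Seq c1 s t1 s1 c2 t2 s2)
  show ?case
  proof (rule SeqE[OF Seq.prems])
    fix u1 r u2
    assume u: "u = u1 + u2" and 1: "exec c1 s u1 r" and 2: "exec c2 r u2 s''"
    from Seq.IH(1)[OF 1] have r: "u1 = t1" "r = s1" by simp_all
    from Seq.IH(2)[OF 2[unfolded r]] u r show ?thesis by simp
  qed
next
  case (IfTrue b s c1 t s1 c2)
  show ?case
  proof (rule IfE[OF IfTrue.prems])
    fix u1 assume "u = Suc u1" "exec c1 s u1 s''"
    with IfTrue.IH[of u1 s''] show ?thesis by simp
  next
    assume "\<not> bval b s" with IfTrue.hyps show ?thesis by simp
  qed
next
  case (IfFalse b s c2 t s1 c1)
  show ?case
  proof (rule IfE[OF IfFalse.prems])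
    assume "bval b s" with IfFalse.hyps show ?thesis by simp
  next
    fix u1 assume "u = Suc u1" "exec c2 s u1 s''"
    with IfFalse.IH[of u1 s''] show ?thesis by simp
  qed
next
  case (WhileFalse b s c)
  from WhileFalse.prems show ?case by (rule WhileE) (use WhileFalse.hyps in simp_all)
next
  case (WhileTrue b s c t1 s1 t2 s2)
  show ?case
  proof (rule WhileE[OF WhileTrue.prems])
    assume "\<not> bval b s"
    with WhileTrue.hyps show ?thesis by simp
  next
    fix u1 r u2
    assume u: "u = Suc (u1 + u2)" and 1: "exec c s u1 r" and 2: "exec (While b c) r u2 s''"
    from WhileTrue.IH(1)[OF 1] have r: "u1 = t1" "r = s1" by simp_all
    from WhileTrue.IH(2)[OF 2[unfolded r]] u r show ?thesis by simp
  qed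
qed


section \<open>Input and output\<close>

text \<open>
  The points of an instance are numbered \<open>0, \<dots>, n - 1\<close>. The distance matrix is stored row by row
  in the array \<open>d\<close>, and all cells not holding input are 0. The output is the set of points
  marked by 1 in the integer array \<open>S\<close>.
\<close>

definition rkc_input ::
  "nat \<Rightarrow> (nat \<Rightarrow> nat \<Rightarrow> real) \<Rightarrow> (nat \<Rightarrow> real) \<Rightarrow> real \<Rightarrow> nat \<Rightarrow> state" where
  "rkc_input n d w k m =
     \<lparr>ints = (\<lambda>a i. if a = ''n'' \<and> i = 0 then int n
                    else if a = ''m'' \<and> i = 0 then int m
                    else 0),
      reals = (\<lambda>a i. if a = ''d'' \<and> 0 \<le> i \<and> i < int (n * n) then d (nat i div n) (nat i mod n)
                     else if a = ''w'' \<and> 0 \<le> i \<and> i < int n then w (nat i)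
                     else if a = ''k'' \<and> i = 0 then k
                     else 0)\<rparr>"

definition output_set :: "nat \<Rightarrow> state \<Rightarrow> nat set" where
  "output_set n s = {v. v < n \<and> ints s ''S'' (int v) = 1}"

end

theory Submission
  imports Defs
begin

text \<open>
  Guess \<open>R\<close> among the pairwise distances. For a fixed \<open>R\<close>, run a perceptron on vectors \<open>y\<close> over the
  points, which stand for (scaled) fractional coverages. Given \<open>y\<close>, cluster greedily: the
  unclustered point with the largest \<open>y\<close> becomes a representative and takes all unclustered points
  within \<open>2 R\<close>. The balls of radius \<open>R\<close> around the representatives are disjoint, so choosing
  representatives is a knapsack problem, where \<open>r\<close> has as profit its cluster size \<open>\<alpha> r\<close> and as cost the
  least weight in its ball. The profits are at most \<open>n\<close>, hence a table over profits solves it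
  exactly for arbitrary weights. Profit \<open>m\<close> within the budget means that \<open>m\<close> points are covered within \<open>3 R\<close>.

  Otherwise, for every solution of radius \<open>R\<close>, with indicator \<open>c\<close> of the covered points, \<open>\<alpha> \<bullet> c \<le> m - 1\<close>
  and \<open>1 \<bullet> c \<ge> m\<close>, while \<open>(1 - \<alpha>) \<bullet> y \<le> 0\<close> by the greedy order. So the update \<open>y := y + (1 - \<alpha>)\<close> increases
  \<open>y \<bullet> c\<close> by at least 1 and the squared norm of \<open>y\<close> by at most \<open>n\<^sup>2\<close>, and by Cauchy-Schwarz there are
  at most \<open>n\<^sup>3\<close> updates. All steps use additions and comparisons only.
\<close>

section \<open>Greedy clustering, knapsack and perceptron\<close>

locale rkc =
  fixes n :: nat and d :: "nat \<Rightarrow> nat \<Rightarrow> real" and w :: "nat \<Rightarrow> real" and k :: real and m :: nat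
  assumes inst: "rkc_instance {..<n} d w k m"
begin

section \<open>Metric facts and coverage by balls\<close>

lemma metric: "Metric_space {..<n} d" and w_nonneg: "v < n \<Longrightarrow> 0 \<le> w v"
  and k_nonneg: "0 \<le> k" and m_le: "m \<le> n"
  using inst by (auto simp: rkc_instance_def)

lemma d_nonneg: "0 \<le> d u v" and d_sym: "d u v = d v u"
  using Metric_space.nonneg[OF metric] Metric_space.commute[OF metric] by auto

lemma d_self: "u < n \<Longrightarrow> d u u = 0"
  using Metric_space.mdist_zero[OF metric] by auto

lemma d_triangle: "u < n \<Longrightarrow> v < n \<Longrightarrow> x < n \<Longrightarrow> d u x \<le> d u v + d v x"
  using Metric_space.triangle[OF metric] by auto

definition covered :: "real \<Rightarrow> nat set \<Rightarrow> nat set" where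
  "covered R S = {v. v < n \<and> (\<exists>u\<in>S. d v u \<le> R)}"

definition near :: "real \<Rightarrow> nat \<Rightarrow> nat set" where
  "near R r = {u. u < n \<and> d r u \<le> R}"

lemma covered_mono: "R \<le> R' \<Longrightarrow> S \<subseteq> S' \<Longrightarrow> covered R S \<subseteq> covered R' S'"
  unfolding covered_def by (auto intro: order_trans)

lemma finite_covered [simp]: "finite (covered R S)"
  and finite_near [simp]: "finite (near R r)"
  by (auto simp: covered_def near_def)

text \<open>
  \<open>A\<close> is the set of clustered points, \<open>\<alpha> r\<close> the size of the cluster with representative \<open>r\<close>
  (0 if \<open>r\<close> is no representative). The knapsack table is indexed by the deficit \<open>q = n - profit\<close>;
  \<open>f q\<close> is the least weight found and \<open>sel q\<close> a set attaining it, values above \<open>k\<close> meaning none.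
\<close>

definition clustering ::
  "real \<Rightarrow> (nat \<Rightarrow> int) \<Rightarrow> nat set \<Rightarrow> (nat \<Rightarrow> nat) \<Rightarrow> bool" where
  "clustering R y A \<alpha> \<longleftrightarrow>
     A \<subseteq> {..<n} \<and>
     (\<forall>v. \<alpha> v > 0 \<longrightarrow> v < n \<and> near (2 * R) v \<subseteq> A) \<and>
     (\<Sum>v<n. \<alpha> v) = card A \<and>
     (\<Sum>u\<in>A. y u) \<le> (\<Sum>v<n. int (\<alpha> v) * y v)"

definition knapsack_sound ::
  "real \<Rightarrow> nat set \<Rightarrow> (nat \<Rightarrow> real) \<Rightarrow> (nat \<Rightarrow> nat set) \<Rightarrow> bool" where
  "knapsack_sound R A f sel \<longleftrightarrow>
     (\<forall>q\<le>n. f q \<le> k \<longrightarrow> sel q \<subseteq> {..<n} \<and> sum w (sel q) \<le> f q \<and>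
        n \<le> q + card (A \<inter> covered (3 * R) (sel q)))"

definition knapsack_complete ::
  "real \<Rightarrow> (nat \<Rightarrow> nat) \<Rightarrow> (nat \<Rightarrow> real) \<Rightarrow> bool" where
  "knapsack_complete R \<alpha> f \<longleftrightarrow>
     (\<forall>S. rkc_feasible {..<n} w k S \<longrightarrow>
        f (n - (\<Sum>v\<in>covered R S. \<alpha> v)) \<le> sum w (S \<inter> (\<Union>v\<in>{v. \<alpha> v > 0}. near R v)))"

section \<open>One greedy clustering step and its knapsack update\<close>

lemma clustering_empty: "clustering R y {} (\<lambda>_. 0)"
  by (simp add: clustering_def)

text \<open>The value \<open>k + 1\<close> plays the role of infinity: being above the budget, it
  exempts every entry but that of deficit \<open>n\<close>, the empty set with profit 0.\<close>

lemma knapsack_sound_init: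
  assumes "f n = 0" "\<And>q. q < n \<Longrightarrow> f q = k + 1" "sel n = {}"
  shows "knapsack_sound R {} f sel"
  unfolding knapsack_sound_def
proof (intro allI impI)
  fix q assume "q \<le> n" "f q \<le> k"
  with assms(2)[of q] have "q = n" by (cases "q < n") auto
  with assms show "sel q \<subseteq> {..<n} \<and> sum w (sel q) \<le> f q \<and>
        n \<le> q + card ({} \<inter> covered (3 * R) (sel q))" by simp
qed

lemma knapsack_complete_init: "f n = 0 \<Longrightarrow> knapsack_complete R (\<lambda>_. 0) f"
  by (simp add: knapsack_complete_def)

text \<open>Otherwise the ball of radius \<open>2 * R\<close> around \<open>r\<close> would lie in
  \<open>A\<close>, and that ball contains \<open>r\<close>.\<close>

lemma fresh_representative:
  assumes "clustering R y A \<alpha>" "0 \<le> R" "r < n" "r \<notin> A"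
  shows "\<alpha> r = 0"
  using assms d_self[of r] by (fastforce simp: clustering_def near_def)

text \<open>No point of \<open>K\<close> has a larger \<open>y\<close> than \<open>r\<close>, so
  \<open>K\<close> adds at most \<open>card K * y r\<close> to the sum over \<open>A\<close>; the
  entry \<open>\<alpha> r\<close>, formerly 0, adds exactly this to the weighted sum.\<close>

lemma clustering_step:
  assumes inv: "clustering R y A \<alpha>" and R: "0 \<le> R" and r: "r < n" "r \<notin> A"
    and max: "\<And>v. v < n \<Longrightarrow> v \<notin> A \<Longrightarrow> y v \<le> y r"
    and K: "K = near (2 * R) r - A"
  shows "clustering R y (A \<union> K) (\<alpha>(r := card K))"
proof -
  have fin: "finite A" "finite K" and disj: "A \<inter> K = {}"
    using inv K finite_subset by (auto simp: clustering_def)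
  have a0: "\<alpha> r = 0" using fresh_representative[OF inv R r] .
  have Ksub: "K \<subseteq> {..<n}" using K by (auto simp: near_def)
  have s1: "(\<Sum>v<n. (\<alpha>(r := card K)) v) = (\<Sum>v<n. \<alpha> v) + card K"
    using r a0 by (simp add: sum.remove[of "{..<n}" r])
  have s2: "(\<Sum>v<n. int ((\<alpha>(r := card K)) v) * y v) = (\<Sum>v<n. int (\<alpha> v) * y v) + int (card K) * y r"
    using r a0 by (simp add: sum.remove[of "{..<n}" r])
  have s3: "(\<Sum>u\<in>A \<union> K. y u) = (\<Sum>u\<in>A. y u) + (\<Sum>u\<in>K. y u)"
    using fin disj by (simp add: sum.union_disjoint)
  have s4: "(\<Sum>u\<in>K. y u) \<le> of_nat (card K) * y r"
    using K by (intro sum_bounded_above max) (auto simp: near_def)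
  have "card (A \<union> K) = card A + card K" using fin disj by (simp add: card_Un_disjoint)
  then show ?thesis
    using inv s1 s2 s3 s4 K Ksub r unfolding clustering_def by auto
qed

text \<open>Points of \<open>K\<close> reach \<open>b\<close> through \<open>r\<close>, at distance
  at most \<open>2 * R + R\<close>; this is where the factor 3 arises. \<open>K\<close> is disjoint
  from \<open>A\<close>, so no point is counted twice when the profit grows by
  \<open>card K\<close>.\<close>

lemma knapsack_sound_step:
  assumes inv: "knapsack_sound R A f sel" and A: "A \<subseteq> {..<n}" and r: "r < n"
    and K: "K = near (2 * R) r - A"
    and b: "b \<in> near R r"
    and f': "\<And>q. q \<le> n \<Longrightarrow> f' q =
      (if q + card K \<le> n \<and> f (q + card K) + w b < f q then f (q + card K) + w b else f q)"
    and sel': "\<And>q. q \<le> n \<Longrightarrow> sel' q =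
      (if q + card K \<le> n \<and> f (q + card K) + w b < f q then insert b (sel (q + card K)) else sel q)"
  shows "knapsack_sound R (A \<union> K) f' sel'"
  unfolding knapsack_sound_def
proof (intro allI impI)
  fix q assume q: "q \<le> n" and fk: "f' q \<le> k"
  have fin: "finite A" "finite K" using A K finite_subset by auto
  have bn: "b < n" using b by (simp add: near_def)
  show "sel' q \<subseteq> {..<n} \<and> sum w (sel' q) \<le> f' q \<and> n \<le> q + card ((A \<union> K) \<inter> covered (3 * R) (sel' q))"
  proof (cases "q + card K \<le> n \<and> f (q + card K) + w b < f q")
    case False
    then have e: "f' q = f q" "sel' q = sel q" using f'[OF q] sel'[OF q] by (simp_all only: if_False)
    have "card (A \<inter> covered (3 * R) (sel q)) \<le> card ((A \<union> K) \<inter> covered (3 * R) (sel q))"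
      by (intro card_mono) auto
    then show ?thesis using inv q fk unfolding e knapsack_sound_def by fastforce
  next
    case True
    let ?q = "q + card K"
    have e: "f' q = f ?q + w b" "sel' q = insert b (sel ?q)"
      using f'[OF q] sel'[OF q] True by simp_all
    have fk': "f ?q \<le> k" using fk e w_nonneg[OF bn] by simp
    have old: "sel ?q \<subseteq> {..<n}" "sum w (sel ?q) \<le> f ?q"
      "n \<le> ?q + card (A \<inter> covered (3 * R) (sel ?q))"
      using inv True fk' unfolding knapsack_sound_def by auto
    have fs: "finite (sel ?q)" using old(1) finite_subset by blast
    have "sum w (insert b (sel ?q)) \<le> w b + sum w (sel ?q)"
      using fs w_nonneg[OF bn] by (cases "b \<in> sel ?q") (auto simp: insert_absorb)
    moreover have "K \<subseteq> covered (3 * R) (insert b (sel ?q))"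
    proof
      fix u assume "u \<in> K"
      then have u: "u < n" "d r u \<le> 2 * R" using K by (auto simp: near_def)
      have "d u b \<le> d u r + d r b" using d_triangle u r bn by blast
      also have "\<dots> \<le> 2 * R + R" using u b d_sym[of u r] by (auto simp: near_def)
      finally show "u \<in> covered (3 * R) (insert b (sel ?q))" using u by (auto simp: covered_def)
    qed
    then have "(A \<inter> covered (3 * R) (sel ?q)) \<union> K \<subseteq> (A \<union> K) \<inter> covered (3 * R) (insert b (sel ?q))"
      using covered_mono[of "3 * R" "3 * R" "sel ?q" "insert b (sel ?q)"] by auto
    then have "card ((A \<inter> covered (3 * R) (sel ?q)) \<union> K) \<le> card ((A \<union> K) \<inter> covered (3 * R) (insert b (sel ?q)))"
      by (intro card_mono) auto
    moreover have "card ((A \<inter> covered (3 * R) (sel ?q)) \<union> K) = card (A \<inter> covered (3 * R) (sel ?q)) + card K"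
      using fin K by (intro card_Un_disjoint) auto
    ultimately show ?thesis using old bn unfolding e by auto
  qed
qed

text \<open>If \<open>S\<close> covers \<open>r\<close>, some \<open>s\<close> in \<open>S\<close>
  lies in the ball of \<open>r\<close>. That ball misses the earlier balls, since a common point
  would put \<open>r\<close> within \<open>2 * R\<close> of an earlier representative and hence into
  \<open>A\<close>. So \<open>s\<close> pays for \<open>b\<close> with weight not charged before;
  this is why completeness compares with the weight of \<open>S\<close> inside the balls.\<close>

lemma knapsack_complete_step:
  assumes inv: "knapsack_complete R \<alpha> f" and cl: "clustering R y A \<alpha>"
    and R: "0 \<le> R" and r: "r < n" "r \<notin> A"
    and K: "K = near (2 * R) r - A"
    and b: "\<And>v. v \<in> near R r \<Longrightarrow> w b \<le> w v"
    and f': "\<And>q. q \<le> n \<Longrightarrow> f' q =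
      (if q + card K \<le> n \<and> f (q + card K) + w b < f q then f (q + card K) + w b else f q)"
  shows "knapsack_complete R (\<alpha>(r := card K)) f'"
  unfolding knapsack_complete_def
proof (intro allI impI)
  fix S assume S: "rkc_feasible {..<n} w k S"
  have Sn: "S \<subseteq> {..<n}" "finite S" using S finite_subset by (auto simp: rkc_feasible_def)
  define U where "U = (\<Union>v\<in>{v. \<alpha> v > 0}. near R v)"
  define U' where "U' = (\<Union>v\<in>{v. (\<alpha>(r := card K)) v > 0}. near R v)"
  define p where "p = (\<Sum>v\<in>covered R S. \<alpha> v)"
  define p' where "p' = (\<Sum>v\<in>covered R S. (\<alpha>(r := card K)) v)"
  have a0: "\<alpha> r = 0" using fresh_representative[OF cl R r] .
  have finA: "finite A" "A \<subseteq> {..<n}" using cl finite_subset by (auto simp: clustering_def)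
  have rK: "r \<in> K" using K r R d_self[of r] by (simp add: near_def)
  have finK: "finite K" using K by simp
  then have Kpos: "card K > 0" using rK by (auto simp: card_gt_0_iff)
  have fp: "f (n - p) \<le> sum w (S \<inter> U)"
    using inv S unfolding knapsack_complete_def p_def U_def by blast
  have UU: "U \<subseteq> U'" using a0 unfolding U_def U'_def by (intro UN_mono) auto
  have "p \<le> (\<Sum>v<n. \<alpha> v)"
    unfolding p_def by (intro sum_mono2) (auto simp: covered_def)
  then have pA: "p \<le> card A" using cl by (simp add: clustering_def)
  \<comment> \<open>The clusters are disjoint sets of points, so the profit stays at most
    \<open>n\<close> and the subtractions in table indices are not truncated.\<close>
  have "card A + card K = card (A \<union> K)" using finA finK K by (subst card_Un_disjoint) auto
  also have "\<dots> \<le> card {..<n}" using finA K by (intro card_mono) (auto simp: near_def)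
  finally have pK: "p + card K \<le> n" using pA by simp
  have "f' (n - p') \<le> sum w (S \<inter> U')"
  proof (cases "r \<in> covered R S")
    case False
    then have "p' = p" unfolding p_def p'_def by (intro sum.cong) auto
    moreover have "f' (n - p) \<le> f (n - p)" using f'[of "n - p"] by auto
    moreover have "sum w (S \<inter> U) \<le> sum w (S \<inter> U')"
      using UU Sn w_nonneg by (intro sum_mono2) auto
    ultimately show ?thesis using fp by simp
  next
    case True
    then obtain s where s: "s \<in> S" "d r s \<le> R" by (auto simp: covered_def)
    then have sn: "s \<in> near R r" using Sn by (auto simp: near_def)
    have p': "p' = p + card K"
      using True a0 unfolding p_def p'_def by (simp add: sum.remove[of "covered R S" r])
    have sU: "s \<notin> U"
    proof
      assume "s \<in> U"
      then obtain v where v: "\<alpha> v > 0" "d v s \<le> R" by (auto simp: U_def near_def)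
      then have vn: "v < n" and vA: "near (2 * R) v \<subseteq> A" using cl by (auto simp: clustering_def)
      have "d v r \<le> d v s + d s r" using d_triangle vn r sn by (auto simp: near_def)
      also have "\<dots> \<le> 2 * R" using v s d_sym[of s r] by simp
      finally have "r \<in> A" using vA r by (auto simp: near_def)
      with r show False by simp
    qed
    have "s \<in> U'" using sn Kpos by (auto simp: U'_def intro!: exI[of _ r])
    then have sub: "insert s (S \<inter> U) \<subseteq> S \<inter> U'"
      using s UU by auto
    \<comment> \<open>Taking \<open>r\<close> lowers the deficit from \<open>n - p\<close> to
      \<open>n - p'\<close>, so the recurrence at \<open>n - p'\<close> reads the old entry
      \<open>n - p\<close>.\<close>
    have q: "n - p' + card K = n - p" "n - p' \<le> n" using p' pK by auto
    have "f' (n - p') \<le> f (n - p) + w b"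
      using f'[OF q(2)] unfolding q(1) by auto
    also have "\<dots> \<le> sum w (S \<inter> U) + w s" using fp b[OF sn] by simp
    also have "\<dots> = sum w (insert s (S \<inter> U))" using sU Sn by simp
    also have "\<dots> \<le> sum w (S \<inter> U')"
      using sub Sn w_nonneg by (intro sum_mono2) auto
    finally show ?thesis .
  qed
  then show "f' (n - (\<Sum>v\<in>covered R S. (\<alpha>(r := card K)) v))
    \<le> sum w (S \<inter> (\<Union>v\<in>{v. (\<alpha>(r := card K)) v > 0}. near R v))"
    unfolding p'_def U'_def .
qed

section \<open>Perceptron estimates\<close>

text \<open>A separating hyperplane: unless the knapsack succeeds, \<open>1 - \<alpha>\<close> has inner product at most 0
  with \<open>y\<close> but at least 1 with the indicator of what any solution of radius \<open>R\<close> covers.\<close>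

lemma perceptron_gain:
  assumes cl: "clustering R y {..<n} \<alpha>" and cp: "knapsack_complete R \<alpha> f"
    and fail: "\<And>q. q < n \<Longrightarrow> q + m \<le> n \<Longrightarrow> k < f q"
    and m: "0 < m"
    and S: "rkc_feasible {..<n} w k S" "m \<le> card (covered R S)"
  shows "(\<Sum>v\<in>covered R S. y v) + 1 \<le> (\<Sum>v\<in>covered R S. y v + 1 - int (\<alpha> v))"
proof -
  define p where "p = (\<Sum>v\<in>covered R S. \<alpha> v)"
  have Sn: "S \<subseteq> {..<n}" "finite S" using S finite_subset by (auto simp: rkc_feasible_def)
  have "p \<le> (\<Sum>v<n. \<alpha> v)"
    unfolding p_def by (intro sum_mono2) (auto simp: covered_def)
  then have pn: "p \<le> n" using cl by (simp add: clustering_def)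
  have "f (n - p) \<le> sum w (S \<inter> (\<Union>v\<in>{v. \<alpha> v > 0}. near R v))"
    using cp S(1) unfolding knapsack_complete_def p_def by blast
  also have "\<dots> \<le> sum w S" using Sn w_nonneg by (intro sum_mono2) auto
  also have "\<dots> \<le> k" using S by (simp add: rkc_feasible_def)
  finally have fk: "f (n - p) \<le> k" .
  have "p < m"
  proof (rule ccontr)
    assume "\<not> p < m"
    \<comment> \<open>A profit of at least \<open>m\<close> would make \<open>n - p\<close> a
      successful entry; the strict bound \<open>n - p < n\<close> comes from \<open>m\<close> being
      positive.\<close>
    then have "n - p < n" "n - p + m \<le> n" using m pn by auto
    with fail fk show False by fastforce
  qed
  then have "int p + 1 \<le> int (card (covered R S))" using S(2) by linarith
  moreover have "(\<Sum>v\<in>covered R S. y v + 1 - int (\<alpha> v))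
      = (\<Sum>v\<in>covered R S. y v) + int (card (covered R S)) - int p"
    by (simp add: p_def sum.distrib sum_subtractf)
  ultimately show ?thesis by linarith
qed

text \<open>Expand the squares. The cross term is twice the inner product of
  \<open>1 - \<alpha>\<close> with \<open>y\<close>, nonpositive by the greedy order; the constants
  sum to \<open>n - 2 * n\<close>, and the squares of \<open>\<alpha>\<close> remain.\<close>

lemma perceptron_norm:
  assumes cl: "clustering R y {..<n} \<alpha>"
  shows "(\<Sum>v<n. (y v + 1 - int (\<alpha> v))\<^sup>2) \<le> (\<Sum>v<n. (y v)\<^sup>2) + (int n)\<^sup>2"
proof -
  have s: "(\<Sum>v<n. int (\<alpha> v)) = int n"
    using cl by (simp add: clustering_def flip: of_nat_sum)
  have "(\<Sum>v<n. (y v + 1 - int (\<alpha> v))\<^sup>2) =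
      (\<Sum>v<n. (y v)\<^sup>2 + 2 * y v - 2 * (int (\<alpha> v) * y v) + (1 - 2 * int (\<alpha> v)) + (int (\<alpha> v))\<^sup>2)"
    by (intro sum.cong) (auto simp: power2_eq_square algebra_simps)
  also have "\<dots> = (\<Sum>v<n. (y v)\<^sup>2) + 2 * (\<Sum>v<n. y v) - 2 * (\<Sum>v<n. int (\<alpha> v) * y v)
      + (int n - 2 * int n) + (\<Sum>v<n. (int (\<alpha> v))\<^sup>2)"
    by (simp add: sum.distrib sum_subtractf s flip: sum_distrib_left)
  \<comment> \<open>Each cluster size is at most \<open>n\<close>, the sum of all of them.\<close>
  also have "(\<Sum>v<n. (int (\<alpha> v))\<^sup>2) \<le> (\<Sum>v<n. int (\<alpha> v) * int n)"
  proof (intro sum_mono)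
    fix v assume v: "v \<in> {..<n}"
    have "int (\<alpha> v) \<le> (\<Sum>v<n. int (\<alpha> v))"
      using v by (intro member_le_sum) auto
    then show "(int (\<alpha> v))\<^sup>2 \<le> int (\<alpha> v) * int n"
      unfolding s power2_eq_square by (intro mult_left_mono) auto
  qed
  also have "(\<Sum>v<n. int (\<alpha> v) * int n) = (int n)\<^sup>2"
    by (simp add: s power2_eq_square flip: sum_distrib_right)
  also have "(\<Sum>v<n. (y v)\<^sup>2) + 2 * (\<Sum>v<n. y v) - 2 * (\<Sum>v<n. int (\<alpha> v) * y v)
      + (int n - 2 * int n) + (int n)\<^sup>2 \<le> (\<Sum>v<n. (y v)\<^sup>2) + (int n)\<^sup>2"
    using cl by (simp add: clustering_def)
  finally show ?thesis by simp
qed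

text \<open>Cauchy-Schwarz with the indicator of \<open>C\<close> bounds \<open>t ^ 2\<close> by
  \<open>n\<close> times the squared norm, hence by \<open>t * n ^ 3\<close>; divide by
  \<open>t\<close>.\<close>

lemma perceptron_terminates:
  fixes y :: "nat \<Rightarrow> int" and t :: nat
  assumes C: "C \<subseteq> {..<n}" and gain: "int t \<le> (\<Sum>v\<in>C. y v)"
    and norm: "(\<Sum>v<n. (y v)\<^sup>2) \<le> int t * (int n)\<^sup>2"
  shows "t \<le> n ^ 3"
proof (cases "t = 0")
  case False
  have "(int t)\<^sup>2 \<le> (\<Sum>v\<in>C. y v)\<^sup>2" using gain by (intro power_mono) auto
  also have "\<dots> = (\<Sum>v\<in>C. y v * 1)\<^sup>2" by simp
  also have "real_of_int \<dots> \<le> real_of_int ((\<Sum>v\<in>C. (y v)\<^sup>2) * (\<Sum>v\<in>C. 1\<^sup>2))"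
    using Cauchy_Schwarz_ineq_sum[of "\<lambda>v. real_of_int (y v)" "\<lambda>_. 1" C] by simp
  then have "(\<Sum>v\<in>C. y v * 1)\<^sup>2 \<le> (\<Sum>v\<in>C. (y v)\<^sup>2) * (\<Sum>v\<in>C. 1\<^sup>2)"
    by (simp only: of_int_le_iff)
  also have "\<dots> \<le> (\<Sum>v<n. (y v)\<^sup>2) * int n"
  proof (intro mult_mono)
    show "(\<Sum>v\<in>C. (y v)\<^sup>2) \<le> (\<Sum>v<n. (y v)\<^sup>2)" using C by (intro sum_mono2) auto
    show "(\<Sum>v\<in>C. 1\<^sup>2) \<le> int n" using card_mono[OF _ C] by simp
  qed (auto intro: sum_nonneg)
  also have "\<dots> \<le> int t * (int n)\<^sup>2 * int n" using norm by (intro mult_right_mono) auto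
  finally have "int t * int t \<le> int t * int (n ^ 3)"
    by (simp add: power2_eq_square power3_eq_cube mult.assoc)
  then have "int t \<le> int (n ^ 3)" using False by (simp only: mult_le_cancel_left)
  then show ?thesis by linarith
qed simp

section \<open>The optimum as a pairwise distance\<close>

lemma set_dist_attained:
  assumes "finite S" "S \<noteq> {}"
  obtains u where "u \<in> S" "set_dist d v S = ennreal (d v u)"
proof -
  have "Inf ((\<lambda>u. ennreal (d v u)) ` S) \<in> (\<lambda>u. ennreal (d v u)) ` S"
    using assms by (simp add: cInf_eq_Min)
  then show thesis using that unfolding set_dist_def by auto
qed

text \<open>The infima and suprema involved range over finite nonempty sets and are attained. So the
  optimum is the distance from a worst point \<open>i\<close> of an optimal \<open>T\<close> to its
  nearest center \<open>j\<close>, and the pairwise distances suffice as guesses for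
  \<open>R\<close>.\<close>

lemma opt_attained:
  assumes m: "0 < m" and fin: "rkc_opt {..<n} d w k m \<noteq> top"
  obtains i j S where "i < n" "j < n" "rkc_opt {..<n} d w k m = ennreal (d i j)"
    "rkc_feasible {..<n} w k S" "m \<le> card (covered (d i j) S)"
proof -
  let ?O = "rkc_opt {..<n} d w k m"
  have "Inf (rkc_cost {..<n} d m ` {S. rkc_feasible {..<n} w k S}) \<in>
      rkc_cost {..<n} d m ` {S. rkc_feasible {..<n} w k S}"
  proof -
    have "finite {S. rkc_feasible {..<n} w k S}"
      by (rule finite_subset[of _ "Pow {..<n}"]) (auto simp: rkc_feasible_def)
    moreover have "{S. rkc_feasible {..<n} w k S} \<noteq> {}"
      using k_nonneg by (auto simp: rkc_feasible_def intro!: exI[of _ "{}"])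
    ultimately show ?thesis by (subst cInf_eq_Min) (auto intro!: Min_in)
  qed
  then obtain S where S: "rkc_feasible {..<n} w k S" "?O = rkc_cost {..<n} d m S"
    unfolding rkc_opt_def by auto
  have "Inf ((\<lambda>T. SUP v\<in>T. set_dist d v S) ` {T. T \<subseteq> {..<n} \<and> card T = m}) \<in>
      (\<lambda>T. SUP v\<in>T. set_dist d v S) ` {T. T \<subseteq> {..<n} \<and> card T = m}"
  proof -
    have "finite {T. T \<subseteq> {..<n} \<and> card T = m}"
      by (rule finite_subset[of _ "Pow {..<n}"]) auto
    moreover have "{T. T \<subseteq> {..<n} \<and> card T = m} \<noteq> {}"
      using m_le by (auto intro!: exI[of _ "{..<m}"])
    ultimately show ?thesis by (subst cInf_eq_Min) (auto intro!: Min_in)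
  qed
  then obtain T where T: "T \<subseteq> {..<n}" "card T = m" "?O = (SUP v\<in>T. set_dist d v S)"
    unfolding S(2) rkc_cost_def by auto
  have finT: "finite T" "T \<noteq> {}" using T m by (auto simp: card_gt_0_iff)
  then have "Sup ((\<lambda>v. set_dist d v S) ` T) \<in> (\<lambda>v. set_dist d v S) ` T"
    by (subst cSup_eq_Max) (auto intro!: Max_in)
  then obtain i where i: "i \<in> T" "?O = set_dist d i S" unfolding T(3) by auto
  \<comment> \<open>For empty \<open>S\<close> the distance would be an infimum over nothing, that
    is \<open>top\<close>.\<close>
  have Sne: "S \<noteq> {}" using i fin by (auto simp: set_dist_def)
  have Sfin: "finite S" "S \<subseteq> {..<n}" using S finite_subset by (auto simp: rkc_feasible_def)
  obtain j where j: "j \<in> S" "set_dist d i S = ennreal (d i j)"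
    using set_dist_attained[OF Sfin(1) Sne] by metis
  have "T \<subseteq> covered (d i j) S"
  proof
    fix v assume v: "v \<in> T"
    obtain u where u: "u \<in> S" "set_dist d v S = ennreal (d v u)"
      using set_dist_attained[OF Sfin(1) Sne] by metis
    have "set_dist d v S \<le> ?O" unfolding T(3) using v by (rule SUP_upper)
    then have "d v u \<le> d i j" unfolding i(2) j(2) u(2) using d_nonneg by (simp add: ennreal_le_iff)
    then show "v \<in> covered (d i j) S" using u v T by (auto simp: covered_def)
  qed
  then have "m \<le> card (covered (d i j) S)" using T(2) card_mono finite_covered by metis
  then show thesis using that[of i j S] i j S T Sfin by auto
qed

text \<open>For \<open>m = 0\<close> there is nothing to cover, and for an infinite optimum every
  point qualifies, so any feasible set will do. Otherwise the optimum is a radius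
  \<open>d i j\<close> to which \<open>cov\<close> applies.\<close>

lemma approx_of_covered:
  assumes feas: "rkc_feasible {..<n} w k S"
    and cov: "\<And>i j S'. 0 < m \<Longrightarrow> i < n \<Longrightarrow> j < n \<Longrightarrow> rkc_feasible {..<n} w k S' \<Longrightarrow>
      m \<le> card (covered (d i j) S') \<Longrightarrow> m \<le> card (covered (3 * d i j) S)"
  shows "rkc_approx 3 {..<n} d w k m S"
proof -
  let ?V = "{v \<in> {..<n}. set_dist d v S \<le> 3 * rkc_opt {..<n} d w k m}"
  have "m \<le> card ?V"
  proof -
    consider "m = 0" | "0 < m" "rkc_opt {..<n} d w k m = top" | "0 < m" "rkc_opt {..<n} d w k m \<noteq> top"
      by blast
    then show ?thesis
    proof cases
      case 2
      then have "?V = {..<n}" by (auto simp: ennreal_mult_top)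
      then show ?thesis using m_le by simp
    next
      case 3
      obtain i j S' where ij: "i < n" "j < n" "rkc_opt {..<n} d w k m = ennreal (d i j)"
        "rkc_feasible {..<n} w k S'" "m \<le> card (covered (d i j) S')"
        using opt_attained[OF 3] by metis
      have "covered (3 * d i j) S \<subseteq> ?V"
      proof
        fix v assume "v \<in> covered (3 * d i j) S"
        then obtain u where u: "v < n" "u \<in> S" "d v u \<le> 3 * d i j" by (auto simp: covered_def)
        have "set_dist d v S \<le> ennreal (d v u)" unfolding set_dist_def using u(2) by (rule INF_lower)
        also have "\<dots> \<le> ennreal (3 * d i j)" using u by (intro ennreal_leI)
        also have "\<dots> = 3 * ennreal (d i j)" using d_nonneg by (simp add: ennreal_mult)
        finally show "v \<in> ?V" using u ij by simp
      qed
      then have "card (covered (3 * d i j) S) \<le> card ?V" by (intro card_mono) auto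
      then show ?thesis using cov[OF 3(1) ij(1,2,4,5)] by simp
    qed simp
  qed
  then show ?thesis using feas by (simp add: rkc_approx_def)
qed

end

section \<open>Weakest preconditions and running time\<close>

fun int_writes :: "com \<Rightarrow> arr set" where
  "int_writes Skip = {}"
| "int_writes (IAssign a i e) = {a}"
| "int_writes (RAssign a i e) = {}"
| "int_writes (Seq c1 c2) = int_writes c1 \<union> int_writes c2"
| "int_writes (If b c1 c2) = int_writes c1 \<union> int_writes c2"
| "int_writes (While b c) = int_writes c"

fun real_writes :: "com \<Rightarrow> arr set" where
  "real_writes Skip = {}"
| "real_writes (IAssign a i e) = {}"
| "real_writes (RAssign a i e) = {a}"
| "real_writes (Seq c1 c2) = real_writes c1 \<union> real_writes c2"
| "real_writes (If b c1 c2) = real_writes c1 \<union> real_writes c2"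
| "real_writes (While b c) = real_writes c"

definition agree :: "arr set \<Rightarrow> arr set \<Rightarrow> state \<Rightarrow> state \<Rightarrow> bool" where
  "agree I R s s' \<longleftrightarrow> (\<forall>a. a \<notin> I \<longrightarrow> ints s' a = ints s a) \<and> (\<forall>a. a \<notin> R \<longrightarrow> reals s' a = reals s a)"

lemma agree_int: "agree I R s s' \<Longrightarrow> a \<notin> I \<Longrightarrow> ints s' a = ints s a"
  and agree_real: "agree I R s s' \<Longrightarrow> a \<notin> R \<Longrightarrow> reals s' a = reals s a"
  by (simp_all add: agree_def)

lemma agree_trans: "agree I R s s' \<Longrightarrow> agree I' R' s' s'' \<Longrightarrow> agree (I \<union> I') (R \<union> R') s s''"
  by (simp add: agree_def)

lemma ints_iupd [simp]: "ints (iupd a i x s) b j = (if b = a \<and> j = i then x else ints s b j)"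
  and reals_iupd [simp]: "reals (iupd a i x s) = reals s"
  and ints_rupd [simp]: "ints (rupd a i y s) = ints s"
  and reals_rupd [simp]: "reals (rupd a i y s) b j = (if b = a \<and> j = i then y else reals s b j)"
  by (simp_all add: iupd_def rupd_def)

lemma exec_agree: "exec c s t s' \<Longrightarrow> agree (int_writes c) (real_writes c) s s'"
  by (induction rule: exec.induct) (auto simp: agree_def iupd_def rupd_def)

section \<open>Partial correctness rules\<close>

text \<open>Only partial correctness; termination comes with the step bounds of
  \<open>poly_time\<close>.\<close>

definition wlp :: "com \<Rightarrow> (state \<Rightarrow> bool) \<Rightarrow> state \<Rightarrow> bool" where
  "wlp c Q s \<longleftrightarrow> (\<forall>t s'. exec c s t s' \<longrightarrow> Q s')"

lemma wlp_Skip [simp]: "wlp Skip Q s \<longleftrightarrow> Q s"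
  unfolding wlp_def by (auto elim: SkipE intro: exec.Skip)

lemma wlp_IAssign [simp]: "wlp (IAssign a i e) Q s \<longleftrightarrow> Q (iupd a (ival i s) (ival e s) s)"
  unfolding wlp_def by (auto elim: IAssignE intro: exec.IAssign)

lemma wlp_RAssign [simp]: "wlp (RAssign a i e) Q s \<longleftrightarrow> Q (rupd a (ival i s) (rval e s) s)"
  unfolding wlp_def by (auto elim: RAssignE intro: exec.RAssign)

lemma wlp_Seq [simp]: "wlp (Seq c1 c2) Q s \<longleftrightarrow> wlp c1 (wlp c2 Q) s"
  unfolding wlp_def by (auto elim!: SeqE intro: exec.Seq)

lemma wlp_If [simp]: "wlp (If b c1 c2) Q s \<longleftrightarrow> (if bval b s then wlp c1 Q s else wlp c2 Q s)"
  unfolding wlp_def by (cases "bval b s") (force elim!: IfE intro: exec.IfTrue exec.IfFalse)+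

text \<open>Besides weakening, this supplies the frame: arrays outside the syntactic write sets are
  unchanged, so postconditions can leave them out.\<close>

lemma wlp_mono:
  assumes "wlp c Q s" "\<And>s'. agree (int_writes c) (real_writes c) s s' \<Longrightarrow> Q s' \<Longrightarrow> Q' s'"
  shows "wlp c Q' s"
  using assms exec_agree unfolding wlp_def by blast

lemma wlp_While:
  assumes "Inv s" "\<And>s. Inv s \<Longrightarrow> bval b s \<Longrightarrow> wlp c Inv s"
  shows "wlp (While b c) (\<lambda>s. Inv s \<and> \<not> bval b s) s"
proof -
  have "exec c' s t s' \<Longrightarrow> c' = While b c \<Longrightarrow> Inv s \<Longrightarrow> Inv s' \<and> \<not> bval b s'" for c' t s'
    by (induction rule: exec.induct) (use assms(2) in \<open>auto simp: wlp_def\<close>)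
  then show ?thesis using assms(1) by (auto simp: wlp_def)
qed

abbreviation V :: "arr \<Rightarrow> iexp" where
  "V x \<equiv> ICell x (IConst 0)"

abbreviation assign :: "arr \<Rightarrow> iexp \<Rightarrow> com" where
  "assign x e \<equiv> IAssign x (IConst 0) e"

text \<open>The guard reads the bound \<open>b\<close> afresh in every round, so the rules for
  \<open>For\<close> demand that the body writes neither \<open>x\<close> nor
  \<open>b\<close>.\<close>

definition For :: "arr \<Rightarrow> arr \<Rightarrow> com \<Rightarrow> com" where
  "For x b c = Seq (assign x (IConst 0))
     (While (ILess (V x) (V b)) (Seq c (assign x (IAdd (V x) (IConst 1)))))"

lemma writes_For [simp]:
  "int_writes (For x b c) = insert x (int_writes c)" "real_writes (For x b c) = real_writes c"
  by (auto simp: For_def)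

text \<open>\<open>Inv i\<close> describes the state before round \<open>i\<close>.
  \<open>indep\<close> carries it across assignments to the counter, and \<open>step\<close> may use
  agreement with the start state \<open>s\<close>, so invariants can omit data computed
  earlier.\<close>

lemma wlp_For:
  assumes vars: "b \<noteq> x" "x \<notin> int_writes c" "b \<notin> int_writes c"
    and bound: "ints s b 0 = int N"
    and init: "Inv 0 s"
    and indep: "\<And>i s' z. Inv i s' \<Longrightarrow> Inv i (iupd x 0 z s')"
    and step: "\<And>i s'. i < N \<Longrightarrow> Inv i s' \<Longrightarrow> ints s' x 0 = int i \<Longrightarrow>
      agree (insert x (int_writes c)) (real_writes c) s s' \<Longrightarrow> wlp c (Inv (Suc i)) s'"
  shows "wlp (For x b c) (Inv N) s"
proof -
  let ?P = "\<lambda>s'. \<exists>i\<le>N. Inv i s' \<and> ints s' x 0 = int i \<and>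
    agree (insert x (int_writes c)) (real_writes c) s s'"
  have "wlp (While (ILess (V x) (V b)) (Seq c (assign x (IAdd (V x) (IConst 1)))))
    (\<lambda>s. ?P s \<and> \<not> bval (ILess (V x) (V b)) s) (iupd x 0 0 s)"
  proof (rule wlp_While)
    show "?P (iupd x 0 0 s)"
      using indep[OF init] by (intro exI[of _ 0]) (auto simp: agree_def iupd_def)
  next
    fix s' assume "?P s'" and g: "bval (ILess (V x) (V b)) s'"
    then obtain i where i: "Inv i s'" "ints s' x 0 = int i"
      "agree (insert x (int_writes c)) (real_writes c) s s'" by blast
    have "ints s' b 0 = int N" using agree_int[OF i(3), of b] vars bound by simp
    then have lt: "i < N" using g i by simp
    have "wlp c (wlp (assign x (IAdd (V x) (IConst 1))) ?P) s'"
    proof (rule wlp_mono[OF step[OF lt i]])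
      fix s'' assume s'': "agree (int_writes c) (real_writes c) s' s''" "Inv (Suc i) s''"
      have x: "ints s'' x 0 = int i" using agree_int[OF s''(1), of x] vars i by simp
      have "agree (insert x (int_writes c)) (real_writes c) s (iupd x 0 (1 + int i) s'')"
        using agree_trans[OF i(3) s''(1)] by (auto simp: agree_def iupd_def)
      then show "wlp (assign x (IAdd (V x) (IConst 1))) ?P s''"
        using indep[OF s''(2)] x lt by (auto intro!: exI[of _ "Suc i"] simp: add.commute)
    qed
    then show "wlp (Seq c (assign x (IAdd (V x) (IConst 1)))) ?P s'" by simp
  qed
  then have "wlp (For x b c) (\<lambda>s. ?P s \<and> \<not> bval (ILess (V x) (V b)) s) s"
    by (simp add: For_def)
  then show ?thesis
  proof (rule wlp_mono)
    fix s' assume "agree (int_writes (For x b c)) (real_writes (For x b c)) s s'"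
      and "?P s' \<and> \<not> bval (ILess (V x) (V b)) s'"
    moreover from this(1) have "ints s' b 0 = int N"
      using agree_int[of _ _ s s' b] vars bound by simp
    ultimately show "Inv N s'" by auto
  qed
qed

section \<open>Running time of loop programs\<close>

text \<open>Every loop is a \<^const>\<open>For\<close> whose bound is one of the variables in \<open>B\<close>, so that the
  running time can be bounded separately from the correctness proof.\<close>

definition poly_time :: "arr set \<Rightarrow> nat poly \<Rightarrow> com \<Rightarrow> bool" where
  "poly_time B N c \<longleftrightarrow> (\<exists>p :: nat poly. \<forall>n (s :: state). (\<forall>b\<in>B. ints s b 0 \<le> int (poly N n)) \<longrightarrow>
     (\<exists>t s'. exec c s t s' \<and> t \<le> poly p n))"

lemma poly_time_Skip: "poly_time B N Skip"
  and poly_time_IAssign: "poly_time B N (IAssign a i e)"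
  and poly_time_RAssign: "poly_time B N (RAssign a i r)"
  unfolding poly_time_def by (intro exI[of _ 1] allI impI, fastforce intro: exec.intros[unfolded One_nat_def])+

lemma poly_time_Seq:
  assumes "poly_time B N c1" "poly_time B N c2" "int_writes c1 \<inter> B = {}"
  shows "poly_time B N (Seq c1 c2)"
proof -
  obtain p1 p2 where p1: "\<And>n (s :: state). (\<forall>b\<in>B. ints s b 0 \<le> int (poly N n)) \<Longrightarrow>
      \<exists>t s'. exec c1 s t s' \<and> t \<le> poly p1 n"
    and p2: "\<And>n (s :: state). (\<forall>b\<in>B. ints s b 0 \<le> int (poly N n)) \<Longrightarrow>
      \<exists>t s'. exec c2 s t s' \<and> t \<le> poly p2 n"
    using assms unfolding poly_time_def by metis
  show ?thesis
    unfolding poly_time_def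
  proof (intro exI[of _ "p1 + p2"] allI impI)
    fix n and s :: state assume b: "\<forall>b\<in>B. ints s b 0 \<le> int (poly N n)"
    obtain t1 s1 where 1: "exec c1 s t1 s1" "t1 \<le> poly p1 n" using p1[OF b] by blast
    have "\<forall>b\<in>B. ints s1 b 0 \<le> int (poly N n)"
      using b assms(3) agree_int[OF exec_agree[OF 1(1)]] by (metis disjoint_iff)
    then obtain t2 s2 where 2: "exec c2 s1 t2 s2" "t2 \<le> poly p2 n" using p2 by blast
    have "t1 + t2 \<le> poly (p1 + p2) n" using 1 2 by (simp add: add_mono)
    then show "\<exists>t s'. exec (Seq c1 c2) s t s' \<and> t \<le> poly (p1 + p2) n"
      using exec.Seq[OF 1(1) 2(1)] by blast
  qed
qed

lemma poly_time_If:
  assumes "poly_time B N c1" "poly_time B N c2"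
  shows "poly_time B N (If g c1 c2)"
proof -
  obtain p1 p2 where p1: "\<And>n (s :: state). (\<forall>b\<in>B. ints s b 0 \<le> int (poly N n)) \<Longrightarrow>
      \<exists>t s'. exec c1 s t s' \<and> t \<le> poly p1 n"
    and p2: "\<And>n (s :: state). (\<forall>b\<in>B. ints s b 0 \<le> int (poly N n)) \<Longrightarrow>
      \<exists>t s'. exec c2 s t s' \<and> t \<le> poly p2 n"
    using assms unfolding poly_time_def by metis
  show ?thesis
    unfolding poly_time_def
  proof (intro exI[of _ "1 + p1 + p2"] allI impI)
    fix n and s :: state assume b: "\<forall>b\<in>B. ints s b 0 \<le> int (poly N n)"
    obtain t1 s1 where 1: "exec c1 s t1 s1" "t1 \<le> poly p1 n" using p1[OF b] by blast
    obtain t2 s2 where 2: "exec c2 s t2 s2" "t2 \<le> poly p2 n" using p2[OF b] by blast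
    have "1 + t1 \<le> poly (1 + p1 + p2) n" "1 + t2 \<le> poly (1 + p1 + p2) n" using 1 2 by simp_all
    then show "\<exists>t s'. exec (If g c1 c2) s t s' \<and> t \<le> poly (1 + p1 + p2) n"
      using exec.IfTrue[OF _ 1(1), of g c2] exec.IfFalse[OF _ 2(1), of g c1] by blast
  qed
qed

lemma poly_time_For:
  assumes c: "poly_time B N c" and B: "x \<notin> B" "b \<in> B" "x \<notin> int_writes c" "int_writes c \<inter> B = {}"
  shows "poly_time B N (For x b c)"
proof -
  obtain p where p: "\<And>n (s :: state). (\<forall>b\<in>B. ints s b 0 \<le> int (poly N n)) \<Longrightarrow>
      \<exists>t s'. exec c s t s' \<and> t \<le> poly p n"
    using c unfolding poly_time_def by metis
  let ?c = "Seq c (assign x (IAdd (V x) (IConst 1)))"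
  let ?g = "ILess (V x) (V b)"
  \<comment> \<open>\<open>j\<close> bounds the remaining rounds. Each costs its body, one guard and
    one increment; the final guard costs 1.\<close>
  have loop: "\<exists>t s'. exec (While ?g ?c) s t s' \<and> t \<le> 1 + j * (poly p n + 2)"
    if "\<forall>b\<in>B. ints s b 0 \<le> int (poly N n)" "int (poly N n) - ints s x 0 \<le> int j" for j n and s :: state
    using that
  proof (induction j arbitrary: s)
    case 0
    then have "\<not> bval ?g s" using B(2) by fastforce
    then show ?case using exec.WhileFalse by fastforce
  next
    case (Suc j)
    show ?case
    proof (cases "bval ?g s")
      case False
      then show ?thesis using exec.WhileFalse by fastforce
    next
      case True
      obtain t s' where 1: "exec c s t s'" "t \<le> poly p n" using p[OF Suc.prems(1)] by blast
      define s'' where "s'' = iupd x 0 (ints s' x 0 + 1) s'"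
      have e: "exec ?c s (t + 1) s''"
        using exec.Seq[OF 1(1) exec.IAssign[of x "IConst 0" "IAdd (V x) (IConst 1)"]]
        by (simp add: s''_def)
      have "ints s' x = ints s x" "\<forall>b\<in>B. ints s' b = ints s b"
        using agree_int[OF exec_agree[OF 1(1)]] B by auto
      then have "\<forall>b\<in>B. ints s'' b 0 \<le> int (poly N n)" "int (poly N n) - ints s'' x 0 \<le> int j"
        using Suc.prems B(1) by (auto simp: s''_def)
      then obtain t' s''' where 2: "exec (While ?g ?c) s'' t' s'''" "t' \<le> 1 + j * (poly p n + 2)"
        using Suc.IH by blast
      show ?thesis using exec.WhileTrue[OF True e 2(1)] 1(2) 2(2)
        by (intro exI conjI) (assumption, simp)
    qed
  qed
  show ?thesis
    unfolding poly_time_def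
  \<comment> \<open>The 2 counts the initial assignment and the final guard.\<close>
  proof (intro exI[of _ "2 + N * (p + 2)"] allI impI)
    fix n and s :: state assume b: "\<forall>b\<in>B. ints s b 0 \<le> int (poly N n)"
    have "\<forall>b\<in>B. ints (iupd x 0 0 s) b 0 \<le> int (poly N n)" using b by auto
    then obtain t s' where l: "exec (While ?g ?c) (iupd x 0 0 s) t s'"
      "t \<le> 1 + poly N n * (poly p n + 2)"
      using loop[of "iupd x 0 0 s" n "poly N n"] by auto
    have "exec (For x b c) s (1 + t) s'"
      using exec.Seq[OF exec.IAssign[of x "IConst 0" "IConst 0" s]] l(1) by (simp add: For_def)
    moreover have "1 + t \<le> poly (2 + N * (p + 2)) n" using l(2) by simp
    ultimately show "\<exists>t s'. exec (For x b c) s t s' \<and> t \<le> poly (2 + N * (p + 2)) n" by blast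
  qed
qed

lemmas poly_time_intros =
  poly_time_Skip poly_time_IAssign poly_time_RAssign poly_time_Seq poly_time_If poly_time_For

section \<open>The program\<close>

text \<open>
  There is no multiplication, so \<open>row\<close> tabulates the multiples of \<open>n\<close>, which address the matrix \<open>d\<close>
  and the table \<open>sel\<close> of subsets. After \<open>pick\<close>, \<open>r = n\<close> means that all points are clustered.
\<close>

abbreviation cand :: rexp where
  "cand \<equiv> RCell ''d'' (V ''e'')"

abbreviation dist_rv :: rexp where
  "dist_rv \<equiv> RCell ''d'' (IAdd (ICell ''row'' (V ''r'')) (V ''v''))"

definition init_table :: com where
  "init_table = Seq
     (For ''v'' ''n'' (Seq (IAssign ''cov'' (V ''v'') (IConst 0))
       (Seq (RAssign ''f'' (V ''v'') (RAdd (RCell ''k'' (IConst 0)) (ROf (IConst 1))))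
         (IAssign ''sel'' (IAdd (ICell ''row'' (V ''n'')) (V ''v'')) (IConst 0)))))
     (RAssign ''f'' (V ''n'') (ROf (IConst 0)))"

definition pick :: com where
  "pick = Seq (assign ''r'' (V ''n''))
     (For ''v'' ''n''
       (If (BAnd (ILess (ICell ''cov'' (V ''v'')) (IConst 1))
             (BNot (BAnd (ILess (V ''r'') (V ''n''))
               (BNot (ILess (ICell ''y'' (V ''r'')) (ICell ''y'' (V ''v'')))))))
         (assign ''r'' (V ''v'')) Skip))"

text \<open>The perceptron update happens in place: a point gains 1 when it is clustered, and its
  representative loses the cluster size. Unclustered points keep their old \<open>y\<close>, so
  later picks follow the original order.\<close>

definition cluster :: com where
  "cluster = Seq (assign ''a'' (IConst 0)) (Seq (assign ''b'' (V ''r''))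
     (Seq (For ''v'' ''n'' (Seq
         (If (BAnd (BNot (RLess (RAdd cand cand) dist_rv)) (ILess (ICell ''cov'' (V ''v'')) (IConst 1)))
           (Seq (IAssign ''cov'' (V ''v'') (IConst 1))
             (Seq (IAssign ''y'' (V ''v'') (IAdd (ICell ''y'' (V ''v'')) (IConst 1)))
               (assign ''a'' (IAdd (V ''a'') (IConst 1))))) Skip)
         (If (BAnd (BNot (RLess cand dist_rv)) (RLess (RCell ''w'' (V ''v'')) (RCell ''w'' (V ''b''))))
           (assign ''b'' (V ''v'')) Skip)))
       (IAssign ''y'' (V ''r'') (ISub (ICell ''y'' (V ''r'')) (V ''a'')))))"

definition copy_set :: com where
  "copy_set = For ''u'' ''n''
     (IAssign ''sel'' (IAdd (ICell ''row'' (V ''q'')) (V ''u''))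
       (ICell ''sel'' (IAdd (ICell ''row'' (IAdd (V ''q'') (V ''a''))) (V ''u''))))"

text \<open>With \<open>q\<close> increasing and \<open>a\<close> positive, entry
  \<open>q + a\<close> is read before it is overwritten, so each representative is taken at most
  once.\<close>

definition knapsack :: com where
  "knapsack = For ''q'' ''n''
     (If (BAnd (ILess (IAdd (V ''q'') (V ''a'')) (IAdd (V ''n'') (IConst 1)))
           (RLess (RAdd (RCell ''f'' (IAdd (V ''q'') (V ''a''))) (RCell ''w'' (V ''b'')))
             (RCell ''f'' (V ''q''))))
       (Seq (RAssign ''f'' (V ''q'')
               (RAdd (RCell ''f'' (IAdd (V ''q'') (V ''a''))) (RCell ''w'' (V ''b''))))
         (Seq copy_set
           (IAssign ''sel'' (IAdd (ICell ''row'' (V ''q'')) (V ''b'')) (IConst 1)))) Skip)"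

definition greedy :: com where
  "greedy = For ''j'' ''n''
     (Seq pick (If (ILess (V ''r'') (V ''n'')) (Seq cluster knapsack) Skip))"

definition save_set :: com where
  "save_set = For ''u'' ''n''
     (IAssign ''S'' (V ''u'') (ICell ''sel'' (IAdd (ICell ''row'' (V ''q'')) (V ''u''))))"

text \<open>The nested negations encode a disjunction: store if nothing is found yet or the current
  radius is below \<open>best\<close>.\<close>

definition record_best :: com where
  "record_best = For ''q'' ''n''
     (If (BAnd (ILess (IAdd (V ''q'') (V ''m'')) (IAdd (V ''n'') (IConst 1)))
           (BAnd (BNot (RLess (RCell ''k'' (IConst 0)) (RCell ''f'' (V ''q''))))
             (BNot (BAnd (BNot (ILess (V ''found'') (IConst 1)))
               (BNot (RLess cand (RCell ''best'' (IConst 0))))))))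
       (Seq (assign ''found'' (IConst 1)) (Seq (RAssign ''best'' (IConst 0) cand) save_set)) Skip)"

definition perceptron :: com where
  "perceptron = Seq (For ''v'' ''n'' (IAssign ''y'' (V ''v'') (IConst 0)))
     (For ''it'' ''N'' (Seq init_table (Seq greedy record_best)))"

definition search :: com where
  "search = For ''e'' ''nn'' perceptron"

text \<open>\<open>N\<close> becomes \<open>n ^ 3 + 1\<close>, one more than the number of updates
  that \<open>perceptron_terminates\<close> allows.\<close>

definition prelude :: com where
  "prelude = Seq
     (For ''v'' ''n'' (IAssign ''row'' (IAdd (V ''v'') (IConst 1)) (IAdd (ICell ''row'' (V ''v'')) (V ''n''))))
     (Seq (assign ''nn'' (ICell ''row'' (V ''n'')))
       (Seq (assign ''N'' (IConst 1))
         (For ''v'' ''n'' (assign ''N'' (IAdd (V ''N'') (V ''nn''))))))"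

section \<open>Write sets and running time of the program\<close>

lemma writes_init_table [simp]:
  "int_writes init_table = {''v'', ''cov'', ''sel''}" "real_writes init_table = {''f''}"
  by (auto simp: init_table_def)

lemma writes_pick [simp]: "int_writes pick = {''r'', ''v''}" "real_writes pick = {}"
  by (auto simp: pick_def)

lemma writes_cluster [simp]:
  "int_writes cluster = {''a'', ''b'', ''v'', ''cov'', ''y''}" "real_writes cluster = {}"
  by (auto simp: cluster_def)

lemma writes_copy_set [simp]: "int_writes copy_set = {''u'', ''sel''}" "real_writes copy_set = {}"
  by (auto simp: copy_set_def)

lemma writes_knapsack [simp]:
  "int_writes knapsack = {''q'', ''u'', ''sel''}" "real_writes knapsack = {''f''}"
  by (auto simp: knapsack_def)

lemma writes_greedy [simp]:
  "int_writes greedy = {''j'', ''r'', ''a'', ''b'', ''v'', ''cov'', ''y'', ''q'', ''u'', ''sel''}"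
  "real_writes greedy = {''f''}"
  by (auto simp: greedy_def)

lemma writes_save_set [simp]: "int_writes save_set = {''u'', ''S''}" "real_writes save_set = {}"
  by (auto simp: save_set_def)

lemma writes_record_best [simp]:
  "int_writes record_best = {''q'', ''found'', ''u'', ''S''}" "real_writes record_best = {''best''}"
  by (auto simp: record_best_def)

lemma writes_perceptron [simp]:
  "int_writes perceptron = {''it'', ''j'', ''r'', ''a'', ''b'', ''v'', ''cov'', ''y'', ''q'', ''u'', ''sel'',
    ''found'', ''S''}"
  "real_writes perceptron = {''f'', ''best''}"
  by (auto simp: perceptron_def)

text \<open>The prelude computes the bounds \<open>nn\<close> and \<open>N\<close>, so its own loops
  are bounded by \<open>n\<close> alone; \<open>search\<close> writes none of the three.\<close>

lemma poly_time_prelude: "poly_time {''n''} N prelude"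
  unfolding prelude_def by (intro poly_time_intros; simp)

lemma poly_time_search: "poly_time {''n'', ''nn'', ''N''} N search"
  unfolding search_def perceptron_def init_table_def greedy_def pick_def cluster_def knapsack_def
    copy_set_def record_best_def save_set_def
  by (intro poly_time_intros; simp)

section \<open>Reading the memory: environment and decoded tables\<close>

context rkc
begin

text \<open>The program keeps no copy of the current radius \<open>R\<close>: it is the matrix cell
  that \<open>e\<close> points to, so it changes only with \<open>e\<close>.\<close>

definition env :: "real \<Rightarrow> state \<Rightarrow> bool" where
  "env R s \<longleftrightarrow> ints s ''n'' 0 = int n \<and> ints s ''m'' 0 = int m \<and>
     (\<forall>i\<le>n. ints s ''row'' (int i) = int i * int n) \<and>
     ints s ''nn'' 0 = int (n * n) \<and> ints s ''N'' 0 = int (n ^ 3 + 1) \<and>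
     (\<forall>i<n. \<forall>j<n. reals s ''d'' (int i * int n + int j) = d i j) \<and>
     (\<forall>v<n. reals s ''w'' (int v) = w v) \<and> reals s ''k'' 0 = k \<and>
     reals s ''d'' (ints s ''e'' 0) = R \<and> 0 \<le> R"

lemma env_vars: "env R s \<Longrightarrow> ints s ''n'' 0 = int n" "env R s \<Longrightarrow> ints s ''m'' 0 = int m"
  "env R s \<Longrightarrow> ints s ''nn'' 0 = int (n * n)" "env R s \<Longrightarrow> ints s ''N'' 0 = int (n ^ 3 + 1)"
  "env R s \<Longrightarrow> i \<le> n \<Longrightarrow> ints s ''row'' (int i) = int i * int n"
  "env R s \<Longrightarrow> i < n \<Longrightarrow> j < n \<Longrightarrow> reals s ''d'' (int i * int n + int j) = d i j"
  "env R s \<Longrightarrow> v < n \<Longrightarrow> reals s ''w'' (int v) = w v" "env R s \<Longrightarrow> reals s ''k'' 0 = k"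
  "env R s \<Longrightarrow> reals s ''d'' (ints s ''e'' 0) = R" "env R s \<Longrightarrow> 0 \<le> R"
  by (simp_all add: env_def)

lemma env_agree:
  assumes "agree I J s s'" "I \<inter> {''n'', ''m'', ''row'', ''nn'', ''N'', ''e''} = {}"
    "J \<inter> {''d'', ''w'', ''k''} = {}" "env R s"
  shows "env R s'"
proof -
  have "ints s' a = ints s a" if "a \<in> {''n'', ''m'', ''row'', ''nn'', ''N'', ''e''}" for a
    using assms(1,2) that by (intro agree_int) auto
  moreover have "reals s' a = reals s a" if "a \<in> {''d'', ''w'', ''k''}" for a
    using assms(1,3) that by (intro agree_real) auto
  ultimately show ?thesis using assms(4) unfolding env_def by simp
qed

text \<open>Uniqueness of quotient and remainder; thus writing to one row of \<open>sel\<close>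
  leaves the other rows alone.\<close>

lemma cell_inject:
  "u < n \<Longrightarrow> v < n \<Longrightarrow> int q * int n + int u = int p * int n + int v \<longleftrightarrow> q = p \<and> u = v"
proof -
  assume "u < n" "v < n"
  then have "q = (q * n + u) div n \<and> u = (q * n + u) mod n" "p = (p * n + v) div n \<and> v = (p * n + v) mod n"
    by auto
  then have "q * n + u = p * n + v \<longleftrightarrow> q = p \<and> u = v" by metis
  then show ?thesis by (metis of_nat_add of_nat_eq_iff of_nat_mult)
qed

definition cov_is :: "state \<Rightarrow> nat set \<Rightarrow> bool" where
  "cov_is s A \<longleftrightarrow> (\<forall>v<n. ints s ''cov'' (int v) < 1 \<longleftrightarrow> v \<notin> A)"

definition y_of :: "state \<Rightarrow> nat \<Rightarrow> int" where
  "y_of s v = ints s ''y'' (int v)"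

definition f_of :: "state \<Rightarrow> nat \<Rightarrow> real" where
  "f_of s q = reals s ''f'' (int q)"

definition sel_of :: "state \<Rightarrow> nat \<Rightarrow> nat set" where
  "sel_of s q = {v. v < n \<and> ints s ''sel'' (int q * int n + int v) = 1}"

section \<open>Correctness of the building blocks\<close>

text \<open>Only row \<open>n\<close> of \<open>sel\<close> is cleared. Stale rows are harmless,
  because soundness makes a claim only for entries of value at most \<open>k\<close>.\<close>

lemma wlp_init_table:
  assumes "env R s"
  shows "wlp init_table (\<lambda>s'. cov_is s' {} \<and> f_of s' n = 0 \<and> (\<forall>q<n. f_of s' q = k + 1) \<and> sel_of s' n = {}) s"
proof -
  define c where "c = Seq (IAssign ''cov'' (V ''v'') (IConst 0))
       (Seq (RAssign ''f'' (V ''v'') (RAdd (RCell ''k'' (IConst 0)) (ROf (IConst 1))))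
         (IAssign ''sel'' (IAdd (ICell ''row'' (V ''n'')) (V ''v'')) (IConst 0)))"
  have wc: "int_writes c = {''cov'', ''sel''}" "real_writes c = {''f''}" by (auto simp: c_def)
  let ?I = "\<lambda>i s'. (\<forall>v<i. ints s' ''cov'' (int v) = 0 \<and> reals s' ''f'' (int v) = k + 1 \<and>
    ints s' ''sel'' (int n * int n + int v) = 0)"
  have "wlp (For ''v'' ''n'' c) (?I n) s"
  proof (rule wlp_For[where Inv = ?I and N = n], unfold wc)
    fix i s'
    assume i: "i < n" and I: "?I i s'" and x: "ints s' ''v'' 0 = int i" and
      ag: "agree {''v'', ''cov'', ''sel''} {''f''} s s'"
    have "env R s'" by (rule env_agree[OF ag _ _ assms]) auto
    note e = env_vars[OF this]
    show "wlp c (?I (Suc i)) s'"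
      using I by (auto simp: c_def x e less_Suc_eq)
  qed (use env_vars[OF assms] in auto)
  then have "wlp init_table (\<lambda>s'. ?I n s' \<and> reals s' ''f'' (int n) = 0) s"
    unfolding init_table_def c_def[symmetric] wlp_Seq[of "For _ _ _"]
    by (rule wlp_mono) (use env_vars[OF assms] agree_int[where a = "''n''"] in \<open>auto simp: wc\<close>)
  then show ?thesis
    by (rule wlp_mono) (auto simp: cov_is_def f_of_def sel_of_def)
qed

lemma wlp_pick:
  assumes e: "env R s" and cov: "cov_is s A" and A: "A \<subseteq> {..<n}"
  shows "wlp pick (\<lambda>s'. A = {..<n} \<and> ints s' ''r'' 0 = int n \<or>
    (\<exists>r<n. ints s' ''r'' 0 = int r \<and> r \<notin> A \<and> (\<forall>v<n. v \<notin> A \<longrightarrow> y_of s v \<le> y_of s r))) s"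
proof -
  define c where "c = If (BAnd (ILess (ICell ''cov'' (V ''v'')) (IConst 1))
             (BNot (BAnd (ILess (V ''r'') (V ''n''))
               (BNot (ILess (ICell ''y'' (V ''r'')) (ICell ''y'' (V ''v'')))))))
         (assign ''r'' (V ''v'')) Skip"
  have wc: "int_writes c = {''r''}" "real_writes c = {}" by (auto simp: c_def)
  \<comment> \<open>Either the prefix is fully clustered and \<open>r\<close> still has its initial
    value \<open>n\<close>, or \<open>r\<close> maximizes \<open>y\<close> over its unclustered
    points.\<close>
  let ?I = "\<lambda>i s'. {..<i} \<subseteq> A \<and> ints s' ''r'' 0 = int n \<or>
    (\<exists>r<n. ints s' ''r'' 0 = int r \<and> r \<notin> A \<and> (\<forall>v<i. v \<notin> A \<longrightarrow> y_of s v \<le> y_of s r))"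
  have "wlp (For ''v'' ''n'' c) (?I n) (iupd ''r'' 0 (int n) s)"
  proof (rule wlp_For[where Inv = ?I and N = n], unfold wc)
    fix i s'
    assume i: "i < n" and I: "?I i s'" and x: "ints s' ''v'' 0 = int i" and
      ag: "agree {''v'', ''r''} {} (iupd ''r'' 0 (int n) s) s'"
    have same: "ints s' ''cov'' = ints s ''cov''" "ints s' ''y'' = ints s ''y''" "ints s' ''n'' = ints s ''n''"
      using ag by (auto simp: agree_def fun_eq_iff)
    have cv: "ints s ''cov'' (int i) < 1 \<longleftrightarrow> i \<notin> A" using cov i by (simp add: cov_is_def)
    from I show "wlp c (?I (Suc i)) s'"
    proof
      assume I: "{..<i} \<subseteq> A \<and> ints s' ''r'' 0 = int n"
      show ?thesis
      proof (cases "i \<in> A")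
        case True
        then show ?thesis using I by (auto simp: c_def x same cv lessThan_Suc)
      next
        case False
        then show ?thesis using I i
          by (auto simp: c_def x same cv lessThan_Suc env_vars[OF e] less_Suc_eq intro!: exI[of _ i])
      qed
    next
      assume "\<exists>r<n. ints s' ''r'' 0 = int r \<and> r \<notin> A \<and> (\<forall>v<i. v \<notin> A \<longrightarrow> y_of s v \<le> y_of s r)"
      then obtain r where r: "r < n" "ints s' ''r'' 0 = int r" "r \<notin> A"
        "\<forall>v<i. v \<notin> A \<longrightarrow> y_of s v \<le> y_of s r" by blast
      show ?thesis
      proof (cases "i \<notin> A \<and> y_of s r < y_of s i")
        case True
        then have "\<exists>r<n. int i = int r \<and> r \<notin> A \<and> (\<forall>v<Suc i. v \<notin> A \<longrightarrow> y_of s v \<le> y_of s r)"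
          using r i by (intro exI[of _ i]) (fastforce simp: less_Suc_eq)
        then show ?thesis using True r by (simp add: c_def x same cv env_vars[OF e] y_of_def)
      next
        case False
        then have "\<exists>r'<n. int r = int r' \<and> r' \<notin> A \<and> (\<forall>v<Suc i. v \<notin> A \<longrightarrow> y_of s v \<le> y_of s r')"
          using r by (intro exI[of _ r]) (fastforce simp: less_Suc_eq)
        then show ?thesis using False r by (auto simp: c_def x same cv env_vars[OF e] y_of_def)
      qed
    qed
  qed (use env_vars[OF e] in auto)
  then have "wlp pick (?I n) s"
    using env_vars[OF e] by (simp add: pick_def flip: c_def)
  then show ?thesis by (rule wlp_mono) (use A in auto)
qed

lemma wlp_cluster:
  assumes e: "env R s" and cov: "cov_is s A" and r: "ints s ''r'' 0 = int r" "r < n"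
    and K: "K = near (2 * R) r - A"
  shows "wlp cluster (\<lambda>s'. cov_is s' (A \<union> K) \<and> ints s' ''a'' 0 = int (card K) \<and>
    (\<forall>v<n. y_of s' v = y_of s v + (if v \<in> K then 1 else 0) - (if v = r then int (card K) else 0)) \<and>
    (\<exists>b\<in>near R r. ints s' ''b'' 0 = int b \<and> (\<forall>v\<in>near R r. w b \<le> w v))) s"
proof -
  define c where "c = Seq
         (If (BAnd (BNot (RLess (RAdd cand cand) dist_rv)) (ILess (ICell ''cov'' (V ''v'')) (IConst 1)))
           (Seq (IAssign ''cov'' (V ''v'') (IConst 1))
             (Seq (IAssign ''y'' (V ''v'') (IAdd (ICell ''y'' (V ''v'')) (IConst 1)))
               (assign ''a'' (IAdd (V ''a'') (IConst 1))))) Skip)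
         (If (BAnd (BNot (RLess cand dist_rv)) (RLess (RCell ''w'' (V ''v'')) (RCell ''w'' (V ''b''))))
           (assign ''b'' (V ''v'')) Skip)"
  have wc: "int_writes c = {''cov'', ''y'', ''a'', ''b''}" "real_writes c = {}" by (auto simp: c_def)
  let ?s = "iupd ''b'' 0 (int r) (iupd ''a'' 0 0 s)"
  let ?K = "\<lambda>i. K \<inter> {..<i}"
  let ?I1 = "\<lambda>i s'. cov_is s' (A \<union> ?K i) \<and> ints s' ''a'' 0 = int (card (?K i)) \<and>
    (\<forall>v<n. y_of s' v = y_of s v + (if v \<in> ?K i then 1 else 0))"
  let ?I2 = "\<lambda>i s'. \<exists>b\<in>near R r. ints s' ''b'' 0 = int b \<and> (\<forall>v\<in>near R r. v < i \<longrightarrow> w b \<le> w v)"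
  have "wlp (For ''v'' ''n'' c) (\<lambda>s'. ?I1 n s' \<and> ?I2 n s') ?s"
  proof (rule wlp_For[where Inv = "\<lambda>i s'. ?I1 i s' \<and> ?I2 i s'" and N = n], unfold wc)
    \<comment> \<open>The initial choice \<open>b = r\<close> is legitimate: \<open>R\<close> is
      nonnegative, so \<open>r\<close> lies in its own ball.\<close>
    show "?I1 0 ?s \<and> ?I2 0 ?s"
      using cov r env_vars(10)[OF e] d_self by (auto simp: cov_is_def y_of_def near_def)
    fix i s'
    assume i: "i < n" and I: "?I1 i s' \<and> ?I2 i s'" and x: "ints s' ''v'' 0 = int i" and
      ag: "agree {''v'', ''cov'', ''y'', ''a'', ''b''} {} ?s s'"
    have e': "env R s'" by (rule env_agree[OF agree_trans[OF _ ag] _ _ e, of "{''a'', ''b''}" "{}"])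
        (auto simp: agree_def iupd_def)
    have r': "ints s' ''r'' 0 = int r" using ag r by (simp add: agree_def)
    have cv: "ints s' ''cov'' (int i) < 1 \<longleftrightarrow> i \<notin> A" using I i by (auto simp: cov_is_def)
    obtain b where b: "b \<in> near R r" "ints s' ''b'' 0 = int b" "\<forall>v\<in>near R r. v < i \<longrightarrow> w b \<le> w v"
      using I by blast
    have bn: "b < n" using b by (simp add: near_def)
    note ee = env_vars[OF e'] env_vars(5)[OF e', of r] env_vars(6)[OF e', of r i]
    have cK: "?K (Suc i) = (if i \<in> K then insert i (?K i) else ?K i)" by (auto simp: less_Suc_eq)
    have cardK: "card (?K (Suc i)) = (if i \<in> K then Suc (card (?K i)) else card (?K i))"
      unfolding cK by auto
    have 1: "i \<in> K \<longleftrightarrow> d r i \<le> 2 * R \<and> i \<notin> A" using i by (auto simp: K near_def)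
    define s1 where "s1 = (if i \<in> K then iupd ''a'' 0 (ints s' ''a'' 0 + 1)
      (iupd ''y'' (int i) (ints s' ''y'' (int i) + 1) (iupd ''cov'' (int i) 1 s')) else s')"
    have I1: "?I1 (Suc i) s1"
      unfolding cardK unfolding cK using I i by (auto simp: s1_def cov_is_def y_of_def)
    have same: "reals s1 = reals s'" "ints s1 ''b'' = ints s' ''b''" "ints s1 ''v'' = ints s' ''v''"
      "ints s1 ''row'' = ints s' ''row''" "ints s1 ''r'' = ints s' ''r''" "ints s1 ''e'' = ints s' ''e''"
      by (auto simp: s1_def fun_eq_iff)
    have "wlp (If (BAnd (BNot (RLess cand dist_rv)) (RLess (RCell ''w'' (V ''v'')) (RCell ''w'' (V ''b''))))
           (assign ''b'' (V ''v'')) Skip) (\<lambda>s'. ?I1 (Suc i) s' \<and> ?I2 (Suc i) s') s1"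
    proof (cases "d r i \<le> R \<and> w i < w b")
      case True
      then have "?I2 (Suc i) (iupd ''b'' 0 (int i) s1)"
        using b i by (fastforce simp: near_def less_Suc_eq)
      moreover have "?I1 (Suc i) (iupd ''b'' 0 (int i) s1)"
        using I1 by (simp add: cov_is_def y_of_def)
      ultimately show ?thesis using True i bn r by (simp add: same x r' b(2) ee del: Int_iff)
    next
      case False
      then have "?I2 (Suc i) s1"
        using b i by (fastforce simp: near_def less_Suc_eq same)
      then show ?thesis using False I1 i bn r by (auto simp: same x r' b(2) ee)
    qed
    then show "wlp c (\<lambda>s'. ?I1 (Suc i) s' \<and> ?I2 (Suc i) s') s'"
      using 1 i r unfolding c_def s1_def by (auto simp: x r' ee cv not_less)
  qed (use env_vars[OF e] in \<open>auto simp: cov_is_def y_of_def\<close>)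
  moreover have "?K n = K" using K by (auto simp: near_def)
  ultimately have loop: "wlp (For ''v'' ''n'' c) (\<lambda>s'. ?I1 n s' \<and> ?I2 n s') ?s" "?K n = K"
    by simp_all
  define Q where "Q s' \<longleftrightarrow> cov_is s' (A \<union> K) \<and> ints s' ''a'' 0 = int (card K) \<and>
    (\<forall>v<n. y_of s' v = y_of s v + (if v \<in> K then 1 else 0) - (if v = r then int (card K) else 0)) \<and>
    (\<exists>b\<in>near R r. ints s' ''b'' 0 = int b \<and> (\<forall>v\<in>near R r. w b \<le> w v))" for s'
  have "wlp (For ''v'' ''n'' c) (wlp (IAssign ''y'' (V ''r'') (ISub (ICell ''y'' (V ''r'')) (V ''a''))) Q) ?s"
  proof (rule wlp_mono[OF loop(1)], unfold loop(2) wlp_IAssign)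
    fix s' assume ag: "agree (int_writes (For ''v'' ''n'' c)) (real_writes (For ''v'' ''n'' c)) ?s s'"
      and post: "(cov_is s' (A \<union> K) \<and> ints s' ''a'' 0 = int (card K) \<and>
        (\<forall>v<n. y_of s' v = y_of s v + (if v \<in> K then 1 else 0))) \<and> ?I2 n s'"
    have r': "ints s' ''r'' 0 = int r" using agree_int[OF ag, of "''r''"] r by (simp add: wc)
    show "Q (iupd ''y'' (ival (V ''r'') s') (ival (ISub (ICell ''y'' (V ''r'')) (V ''a'')) s') s')"
      using post unfolding Q_def by (auto simp: r' cov_is_def y_of_def near_def)
  qed
  then have "wlp cluster Q s"
    unfolding cluster_def c_def[symmetric] using r by simp
  then show ?thesis by (rule wlp_mono) (simp add: Q_def)
qed

text \<open>Since \<open>a\<close> is positive, the source row \<open>q + a\<close> differs from the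
  target row and is not overwritten during the copy.\<close>

lemma wlp_copy_set:
  assumes e: "env R s" and q: "ints s ''q'' 0 = int q" "ints s ''a'' 0 = int a" "q + a \<le> n" "0 < a"
  shows "wlp copy_set (\<lambda>s'. sel_of s' q = sel_of s (q + a) \<and> (\<forall>p. p \<noteq> q \<longrightarrow> sel_of s' p = sel_of s p)) s"
proof -
  let ?I = "\<lambda>i s'. \<forall>p. \<forall>v<n. ints s' ''sel'' (int p * int n + int v) =
    (if p = q \<and> v < i then ints s ''sel'' (int (q + a) * int n + int v)
     else ints s ''sel'' (int p * int n + int v))"
  have "wlp copy_set (?I n) s"
    unfolding copy_set_def
  proof (rule wlp_For[where Inv = ?I and N = n], unfold int_writes.simps real_writes.simps)
    fix i s'
    assume i: "i < n" and I: "?I i s'" and x: "ints s' ''u'' 0 = int i" and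
      ag: "agree {''u'', ''sel''} {} s s'"
    have e': "env R s'" by (rule env_agree[OF ag _ _ e]) auto
    have q': "ints s' ''q'' 0 = int q" "ints s' ''a'' 0 = int a" using ag q by (auto simp: agree_def)
    have row: "ints s' ''row'' (int q + int a) = int (q + a) * int n"
      using env_vars(5)[OF e', of "q + a"] q by simp
    have row': "ints s' ''row'' (int q) = int q * int n"
      using env_vars(5)[OF e', of q] q by simp
    have I': "ints s' ''sel'' (int (q + a) * int n + int i) = ints s ''sel'' (int (q + a) * int n + int i)"
      using I[rule_format, of i "q + a"] i q by simp
    show "wlp (IAssign ''sel'' (IAdd (ICell ''row'' (V ''q'')) (V ''u''))
       (ICell ''sel'' (IAdd (ICell ''row'' (IAdd (V ''q'') (V ''a''))) (V ''u'')))) (?I (Suc i)) s'"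
    proof (simp only: wlp_IAssign ival.simps x q' row row' I', intro allI impI)
      fix p v assume v: "v < n"
      show "ints (iupd ''sel'' (int q * int n + int i) (ints s ''sel'' (int (q + a) * int n + int i)) s') ''sel''
            (int p * int n + int v) = (if p = q \<and> v < Suc i then ints s ''sel'' (int (q + a) * int n + int v)
              else ints s ''sel'' (int p * int n + int v))"
        using I v i cell_inject[OF v i, of p q] by (auto simp: less_Suc_eq simp del: of_nat_add)
    qed
  qed (use env_vars[OF e] in auto)
  then show ?thesis by (rule wlp_mono) (use q in \<open>auto simp: sel_of_def\<close>)
qed

lemma wlp_knapsack:
  assumes e: "env R s" and a: "ints s ''a'' 0 = int a" "0 < a" and b: "ints s ''b'' 0 = int b" "b < n"
  shows "wlp knapsack (\<lambda>s'. (\<forall>q\<le>n. f_of s' q =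
      (if q + a \<le> n \<and> f_of s (q + a) + w b < f_of s q then f_of s (q + a) + w b else f_of s q)) \<and>
    (\<forall>q\<le>n. sel_of s' q =
      (if q + a \<le> n \<and> f_of s (q + a) + w b < f_of s q then insert b (sel_of s (q + a)) else sel_of s q))) s"
proof -
  define better where "better q \<longleftrightarrow> q + a \<le> n \<and> f_of s (q + a) + w b < f_of s q" for q
  define c where "c = If (BAnd (ILess (IAdd (V ''q'') (V ''a'')) (IAdd (V ''n'') (IConst 1)))
           (RLess (RAdd (RCell ''f'' (IAdd (V ''q'') (V ''a''))) (RCell ''w'' (V ''b'')))
             (RCell ''f'' (V ''q''))))
       (Seq (RAssign ''f'' (V ''q'')
               (RAdd (RCell ''f'' (IAdd (V ''q'') (V ''a''))) (RCell ''w'' (V ''b''))))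
         (Seq copy_set
           (IAssign ''sel'' (IAdd (ICell ''row'' (V ''q'')) (V ''b'')) (IConst 1)))) Skip"
  have wc: "int_writes c = {''u'', ''sel''}" "real_writes c = {''f''}" by (auto simp: c_def)
  let ?I = "\<lambda>i s'. (\<forall>q. f_of s' q = (if q < i \<and> better q then f_of s (q + a) + w b else f_of s q)) \<and>
    (\<forall>q. sel_of s' q = (if q < i \<and> better q then insert b (sel_of s (q + a)) else sel_of s q))"
  have "wlp knapsack (?I n) s"
    unfolding knapsack_def c_def[symmetric]
  proof (rule wlp_For[where Inv = ?I and N = n], unfold wc)
    fix i s'
    assume i: "i < n" and I: "?I i s'" and x: "ints s' ''q'' 0 = int i" and
      ag: "agree {''q'', ''u'', ''sel''} {''f''} s s'"
    have e': "env R s'" by (rule env_agree[OF ag _ _ e]) auto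
    have ab: "ints s' ''a'' 0 = int a" "ints s' ''b'' 0 = int b" using ag a b by (auto simp: agree_def)
    \<comment> \<open>Neither \<open>i\<close> nor \<open>i + a\<close> has been treated yet, so
      both entries still have their values from \<open>s\<close>.\<close>
    have f: "reals s' ''f'' (int i) = f_of s i" "reals s' ''f'' (int i + int a) = f_of s (i + a)"
      using I[THEN conjunct1, rule_format, of i] I[THEN conjunct1, rule_format, of "i + a"]
      by (simp_all add: f_of_def)
    have sel: "sel_of s' (i + a) = sel_of s (i + a)" "sel_of s' i = sel_of s i"
      using I[THEN conjunct2] by simp_all
    have guard: "bval (BAnd (ILess (IAdd (V ''q'') (V ''a'')) (IAdd (V ''n'') (IConst 1)))
           (RLess (RAdd (RCell ''f'' (IAdd (V ''q'') (V ''a''))) (RCell ''w'' (V ''b'')))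
             (RCell ''f'' (V ''q'')))) s' \<longleftrightarrow> better i"
      using b by (auto simp: x ab f env_vars[OF e'] better_def)
    show "wlp c (?I (Suc i)) s'"
    proof (cases "better i")
      case False
      then show ?thesis unfolding c_def wlp_If guard using I by (auto simp: less_Suc_eq)
    next
      case True
      define s1 where "s1 = rupd ''f'' (int i) (f_of s (i + a) + w b) s'"
      have e1: "env R s1" by (rule env_agree[OF _ _ _ e', of "{}" "{''f''}"]) (auto simp: s1_def agree_def rupd_def)
      have "wlp copy_set (wlp (IAssign ''sel'' (IAdd (ICell ''row'' (V ''q'')) (V ''b'')) (IConst 1)) (?I (Suc i))) s1"
      proof (rule wlp_mono[OF wlp_copy_set[OF e1, of i a]], unfold wlp_IAssign)
        show "ints s1 ''q'' 0 = int i" "ints s1 ''a'' 0 = int a" "i + a \<le> n" "0 < a"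
          using x ab True a by (auto simp: s1_def better_def)
        fix s2 assume ag2: "agree (int_writes copy_set) (real_writes copy_set) s1 s2"
          and s2: "sel_of s2 i = sel_of s1 (i + a) \<and> (\<forall>p. p \<noteq> i \<longrightarrow> sel_of s2 p = sel_of s1 p)"
        have e2: "env R s2" by (rule env_agree[OF ag2 _ _ e1]) auto
        have q2: "ints s2 ''q'' 0 = int i" "ints s2 ''b'' 0 = int b"
          using agree_int[OF ag2, of "''q''"] agree_int[OF ag2, of "''b''"] x ab by (simp_all add: s1_def)
        have f2: "f_of s2 q = (if q = i then f_of s (i + a) + w b else f_of s' q)" for q
          using agree_real[OF ag2, of "''f''"] by (simp add: f_of_def s1_def)
        have sel1: "sel_of s1 = sel_of s'" by (simp add: sel_of_def s1_def fun_eq_iff)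
        define s3 where "s3 = iupd ''sel'' (int i * int n + int b) 1 s2"
        have f3: "f_of s3 = f_of s2" by (simp add: s3_def f_of_def fun_eq_iff)
        have sel3: "sel_of s3 q = (if q = i then insert b (sel_of s2 q) else sel_of s2 q)" for q
          using b by (auto simp: s3_def sel_of_def cell_inject)
        have "?I (Suc i) s3"
          using I True s2 sel by (auto simp: f3 f2 sel3 sel1 less_Suc_eq)
        then show "?I (Suc i) (iupd ''sel'' (ival (IAdd (ICell ''row'' (V ''q'')) (V ''b'')) s2) (ival (IConst 1) s2) s2)"
          using env_vars(5)[OF e2, of i] i by (simp add: q2 s3_def del: of_nat_add)
      qed
      then show ?thesis
        unfolding c_def wlp_If guard using True b
        by (simp only: if_True wlp_Seq wlp_RAssign ival.simps rval.simps x ab f env_vars(7)[OF e'] s1_def)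
    qed
  qed (use env_vars[OF e] in \<open>auto simp: f_of_def sel_of_def\<close>)
  then show ?thesis
  proof (rule wlp_mono)
    fix s' assume "?I n s'"
    \<comment> \<open>For \<open>q = n\<close> the condition \<open>q + a \<le> n\<close> fails
      because \<open>a\<close> is positive, so a loop over \<open>q < n\<close> settles all deficits
      up to \<open>n\<close>.\<close>
    moreover have "q < n \<and> better q \<longleftrightarrow> q + a \<le> n \<and> f_of s (q + a) + w b < f_of s q" for q
      using a by (auto simp: better_def)
    ultimately show "(\<forall>q\<le>n. f_of s' q =
      (if q + a \<le> n \<and> f_of s (q + a) + w b < f_of s q then f_of s (q + a) + w b else f_of s q)) \<and>
    (\<forall>q\<le>n. sel_of s' q =
      (if q + a \<le> n \<and> f_of s (q + a) + w b < f_of s q then insert b (sel_of s (q + a)) else sel_of s q))"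
      by simp
  qed
qed

section \<open>The greedy loop\<close>

text \<open>\<open>\<alpha>\<close> is a ghost value, and \<open>y\<close> is the vector before the
  pass. The last clause describes the part of the in-place update done so far; once \<open>A\<close>
  contains all points it reads \<open>y + 1 - \<alpha>\<close>.\<close>

definition greedy_state :: "real \<Rightarrow> (nat \<Rightarrow> int) \<Rightarrow> nat set \<Rightarrow> (nat \<Rightarrow> nat) \<Rightarrow> state \<Rightarrow> bool" where
  "greedy_state R y A \<alpha> s \<longleftrightarrow> cov_is s A \<and> clustering R y A \<alpha> \<and>
     knapsack_sound R A (f_of s) (sel_of s) \<and> knapsack_complete R \<alpha> (f_of s) \<and>
     (\<forall>v<n. y_of s v = y v + (if v \<in> A then 1 else 0) - int (\<alpha> v))"

lemma greedy_state_cong: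
  assumes "greedy_state R y A \<alpha> s" "ints s' ''cov'' = ints s ''cov''" "ints s' ''sel'' = ints s ''sel''"
    "ints s' ''y'' = ints s ''y''" "reals s' ''f'' = reals s ''f''"
  shows "greedy_state R y A \<alpha> s'"
proof -
  have "f_of s' = f_of s" "sel_of s' = sel_of s" using assms by (auto simp: f_of_def sel_of_def fun_eq_iff)
  then show ?thesis using assms by (simp add: greedy_state_def cov_is_def y_of_def)
qed

lemma wlp_greedy_step:
  assumes e: "env R s" and g: "greedy_state R y A \<alpha> s" and r: "ints s ''r'' 0 = int r" "r < n" "r \<notin> A"
    and max: "\<forall>v<n. v \<notin> A \<longrightarrow> y_of s v \<le> y_of s r"
  shows "wlp (Seq cluster knapsack) (\<lambda>s'. \<exists>A' \<alpha>'. greedy_state R y A' \<alpha>' s' \<and> card A < card A') s"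
proof -
  define K where "K = near (2 * R) r - A"
  have R: "0 \<le> R" using env_vars[OF e] by simp
  have cl: "clustering R y A \<alpha>" using g by (simp add: greedy_state_def)
  then have A: "A \<subseteq> {..<n}" "finite A" using finite_subset by (auto simp: clustering_def)
  have a0: "\<alpha> v = 0" if "v < n" "v \<notin> A" for v using fresh_representative[OF cl R that] .
  \<comment> \<open>Unclustered points have \<open>\<alpha> v = 0\<close> and have not gained their
    1, so the stored values compared are the original ones.\<close>
  have max': "y v \<le> y r" if "v < n" "v \<notin> A" for v
    using max g that r a0 unfolding greedy_state_def by (metis add_0_right diff_0_right of_nat_0)
  have "r \<in> K" "finite K" using r R d_self[of r] by (auto simp: K_def near_def)
  then have Kpos: "0 < card K" by (auto simp: card_gt_0_iff)
  have "card (A \<union> K) = card A + card K"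
    using A \<open>finite K\<close> by (intro card_Un_disjoint) (auto simp: K_def)
  then have grow: "card A < card (A \<union> K)" using Kpos by simp
  have cl': "clustering R y (A \<union> K) (\<alpha>(r := card K))"
    using clustering_step[OF cl R r(2,3) max' K_def] .
  have cov: "cov_is s A" using g by (simp add: greedy_state_def)
  show ?thesis
    unfolding wlp_Seq
  proof (rule wlp_mono[OF wlp_cluster[OF e cov r(1,2) K_def]], elim conjE bexE)
    fix s1 b assume ag: "agree (int_writes cluster) (real_writes cluster) s s1"
      and cov1: "cov_is s1 (A \<union> K)" and a: "ints s1 ''a'' 0 = int (card K)"
      and y1: "\<forall>v<n. y_of s1 v = y_of s v + (if v \<in> K then 1 else 0) - (if v = r then int (card K) else 0)"
      and b: "b \<in> near R r" "ints s1 ''b'' 0 = int b" "\<forall>v\<in>near R r. w b \<le> w v"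
    have e1: "env R s1" by (rule env_agree[OF ag _ _ e]) auto
    have fs: "f_of s1 = f_of s" "sel_of s1 = sel_of s"
      using agree_int[OF ag, of "''sel''"] agree_real[OF ag, of "''f''"]
      by (auto simp: f_of_def sel_of_def fun_eq_iff)
    have bn: "b < n" using b by (simp add: near_def)
    show "wlp knapsack (\<lambda>s'. \<exists>A' \<alpha>'. greedy_state R y A' \<alpha>' s' \<and> card A < card A') s1"
    proof (rule wlp_mono[OF wlp_knapsack[OF e1 a Kpos b(2) bn]], unfold fs, elim conjE)
      fix s2 assume ag2: "agree (int_writes knapsack) (real_writes knapsack) s1 s2"
        and f2: "\<forall>q\<le>n. f_of s2 q = (if q + card K \<le> n \<and> f_of s (q + card K) + w b < f_of s q
          then f_of s (q + card K) + w b else f_of s q)"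
        and sel2: "\<forall>q\<le>n. sel_of s2 q = (if q + card K \<le> n \<and> f_of s (q + card K) + w b < f_of s q
          then insert b (sel_of s (q + card K)) else sel_of s q)"
      have "knapsack_sound R (A \<union> K) (f_of s2) (sel_of s2)"
        using g by (intro knapsack_sound_step[OF _ A(1) r(2) K_def b(1) f2[rule_format] sel2[rule_format]])
          (auto simp: greedy_state_def)
      moreover have "knapsack_complete R (\<alpha>(r := card K)) (f_of s2)"
        using g by (intro knapsack_complete_step[OF _ cl R r(2,3) K_def b(3)[rule_format] f2[rule_format]])
          (auto simp: greedy_state_def)
      moreover have "cov_is s2 (A \<union> K)" "y_of s2 = y_of s1"
        using cov1 agree_int[OF ag2, of "''cov''"] agree_int[OF ag2, of "''y''"]
        by (auto simp: cov_is_def y_of_def fun_eq_iff)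
      moreover have "y_of s1 v = y v + (if v \<in> A \<union> K then 1 else 0) - int ((\<alpha>(r := card K)) v)" if "v < n" for v
        using y1 g that a0[OF r(2,3)] K_def by (auto simp: greedy_state_def)
      ultimately have "greedy_state R y (A \<union> K) (\<alpha>(r := card K)) s2"
        using cl' by (simp add: greedy_state_def)
      then show "\<exists>A' \<alpha>'. greedy_state R y A' \<alpha>' s2 \<and> card A < card A'" using grow by blast
    qed
  qed
qed

lemma wlp_greedy:
  assumes e: "env R s" and g: "greedy_state R y {} (\<lambda>_. 0) s"
  shows "wlp greedy (\<lambda>s'. \<exists>\<alpha>. greedy_state R y {..<n} \<alpha> s') s"
proof -
  define c where "c = Seq pick (If (ILess (V ''r'') (V ''n'')) (Seq cluster knapsack) Skip)"
  have wc: "int_writes c = {''r'', ''a'', ''b'', ''v'', ''cov'', ''y'', ''q'', ''u'', ''sel''}"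
    "real_writes c = {''f''}"
    by (auto simp: c_def)
  \<comment> \<open>Every round clusters at least the picked point, so \<open>n\<close> rounds
    exhaust the points.\<close>
  let ?I = "\<lambda>i s'. \<exists>A \<alpha>. greedy_state R y A \<alpha> s' \<and> (i \<le> card A \<or> A = {..<n})"
  have "wlp greedy (?I n) s"
    unfolding greedy_def c_def[symmetric]
  proof (rule wlp_For[where Inv = ?I and N = n], unfold wc)
    show "?I 0 s" using g by auto
    fix i s' z assume "?I i s'"
    then show "?I i (iupd ''j'' 0 z s')"
      by (elim ex_forward conj_forward disj_forward; assumption?) (erule greedy_state_cong; simp add: fun_eq_iff)
  next
    fix i s'
    assume i: "i < n" and I: "?I i s'" and x: "ints s' ''j'' 0 = int i" and
      ag: "agree {''j'', ''r'', ''a'', ''b'', ''v'', ''cov'', ''y'', ''q'', ''u'', ''sel''} {''f''} s s'"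
    have e': "env R s'" by (rule env_agree[OF ag _ _ e]) auto
    obtain A \<alpha> where A: "greedy_state R y A \<alpha> s'" "i \<le> card A \<or> A = {..<n}" using I by blast
    have cov: "cov_is s' A" "A \<subseteq> {..<n}" using A by (auto simp: greedy_state_def clustering_def)
    show "wlp c (?I (Suc i)) s'"
      unfolding c_def wlp_Seq
    proof (rule wlp_mono[OF wlp_pick[OF e' cov]])
      fix s1 assume ag1: "agree (int_writes pick) (real_writes pick) s' s1"
        and r: "A = {..<n} \<and> ints s1 ''r'' 0 = int n \<or> (\<exists>r<n. ints s1 ''r'' 0 = int r \<and> r \<notin> A \<and>
          (\<forall>v<n. v \<notin> A \<longrightarrow> y_of s' v \<le> y_of s' r))"
      have e1: "env R s1" by (rule env_agree[OF ag1 _ _ e']) auto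
      have A1: "greedy_state R y A \<alpha> s1"
        by (rule greedy_state_cong[OF A(1)]) (use ag1 in \<open>auto simp: agree_def\<close>)
      have y1: "y_of s1 = y_of s'" using ag1 by (auto simp: agree_def y_of_def fun_eq_iff)
      from r show "wlp (If (ILess (V ''r'') (V ''n'')) (Seq cluster knapsack) Skip) (?I (Suc i)) s1"
      proof
        assume "A = {..<n} \<and> ints s1 ''r'' 0 = int n"
        then show ?thesis using A1 env_vars[OF e1] by auto
      next
        assume "\<exists>r<n. ints s1 ''r'' 0 = int r \<and> r \<notin> A \<and> (\<forall>v<n. v \<notin> A \<longrightarrow> y_of s' v \<le> y_of s' r)"
        then obtain r where r: "ints s1 ''r'' 0 = int r" "r < n" "r \<notin> A"
          "\<forall>v<n. v \<notin> A \<longrightarrow> y_of s1 v \<le> y_of s1 r" unfolding y1 by blast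
        have ne: "A \<noteq> {..<n}" using r by auto
        have "wlp (Seq cluster knapsack) (?I (Suc i)) s1"
          by (rule wlp_mono[OF wlp_greedy_step[OF e1 A1 r]]) (use A(2) ne in force)
        then show ?thesis using r env_vars[OF e1] by simp
      qed
    qed
  qed (use env_vars[OF e] in auto)
  then show ?thesis
  proof (rule wlp_mono, elim exE conjE)
    fix s' A \<alpha> assume A: "greedy_state R y A \<alpha> s'" "n \<le> card A \<or> A = {..<n}"
    then have "A \<subseteq> {..<n}" by (auto simp: greedy_state_def clustering_def)
    then have "A = {..<n}" using A(2) card_subset_eq[of "{..<n}" A] card_mono[of "{..<n}" A] by auto
    then show "\<exists>\<alpha>. greedy_state R y {..<n} \<alpha> s'" using A by blast
  qed
qed

section \<open>Recording solutions and iterating the perceptron\<close>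

text \<open>Once true for \<open>x\<close>, this stays true, since a recorded \<open>best\<close> is
  replaced only by a smaller one.\<close>

definition solved :: "state \<Rightarrow> real \<Rightarrow> bool" where
  "solved s x \<longleftrightarrow> 1 \<le> ints s ''found'' 0 \<and> reals s ''best'' 0 \<le> x"

text \<open>Feasibility is demanded even before anything is found: the initial empty output is the
  answer if no solution is ever recorded.\<close>

definition output_ok :: "state \<Rightarrow> bool" where
  "output_ok s \<longleftrightarrow> rkc_feasible {..<n} w k (output_set n s) \<and>
     (1 \<le> ints s ''found'' 0 \<longrightarrow> m \<le> card (covered (3 * reals s ''best'' 0) (output_set n s)))"

lemma wlp_save_set:
  assumes e: "env R s" and q: "ints s ''q'' 0 = int q" "q \<le> n"
  shows "wlp save_set (\<lambda>s'. output_set n s' = sel_of s q) s"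
proof -
  let ?I = "\<lambda>i s'. \<forall>v<i. ints s' ''S'' (int v) = ints s ''sel'' (int q * int n + int v)"
  have "wlp save_set (?I n) s"
    unfolding save_set_def
  proof (rule wlp_For[where Inv = ?I and N = n], unfold int_writes.simps real_writes.simps)
    fix i s'
    assume i: "i < n" and I: "?I i s'" and x: "ints s' ''u'' 0 = int i" and
      ag: "agree {''u'', ''S''} {} s s'"
    have e': "env R s'" by (rule env_agree[OF ag _ _ e]) auto
    have q': "ints s' ''q'' 0 = int q" "ints s' ''sel'' = ints s ''sel''" using ag q by (auto simp: agree_def)
    show "wlp (IAssign ''S'' (V ''u'') (ICell ''sel'' (IAdd (ICell ''row'' (V ''q'')) (V ''u'')))) (?I (Suc i)) s'"
      using I by (auto simp: x q' q(2) env_vars[OF e'] less_Suc_eq)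
  qed (use env_vars[OF e] in auto)
  then show ?thesis by (rule wlp_mono) (auto simp: sel_of_def output_set_def)
qed

lemma wlp_record_best:
  assumes e: "env R s" and ok: "output_ok s"
    and sound: "knapsack_sound R {..<n} (f_of s) (sel_of s)"
  shows "wlp record_best (\<lambda>s'. output_ok s' \<and> (\<forall>x. solved s x \<longrightarrow> solved s' x) \<and>
    ((\<exists>q<n. q + m \<le> n \<and> f_of s q \<le> k) \<longrightarrow> solved s' R)) s"
proof -
  define c where "c = If (BAnd (ILess (IAdd (V ''q'') (V ''m'')) (IAdd (V ''n'') (IConst 1)))
           (BAnd (BNot (RLess (RCell ''k'' (IConst 0)) (RCell ''f'' (V ''q''))))
             (BNot (BAnd (BNot (ILess (V ''found'') (IConst 1)))
               (BNot (RLess cand (RCell ''best'' (IConst 0))))))))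
       (Seq (assign ''found'' (IConst 1)) (Seq (RAssign ''best'' (IConst 0) cand) save_set)) Skip"
  have wc: "int_writes c = {''found'', ''u'', ''S''}" "real_writes c = {''best''}" by (auto simp: c_def)
  let ?I = "\<lambda>i s'. output_ok s' \<and> (\<forall>x. solved s x \<longrightarrow> solved s' x) \<and>
    ((\<exists>q<i. q + m \<le> n \<and> f_of s q \<le> k) \<longrightarrow> solved s' R)"
  have "wlp record_best (?I n) s"
    unfolding record_best_def c_def[symmetric]
  proof (rule wlp_For[where Inv = ?I and N = n], unfold wc)
    fix i s'
    assume i: "i < n" and I: "?I i s'" and x: "ints s' ''q'' 0 = int i" and
      ag: "agree {''q'', ''found'', ''u'', ''S''} {''best''} s s'"
    have e': "env R s'" by (rule env_agree[OF ag _ _ e]) auto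
    have same: "reals s' ''f'' = reals s ''f''" "ints s' ''sel'' = ints s ''sel''"
      using ag by (auto simp: agree_def)
    have guard: "bval (BAnd (ILess (IAdd (V ''q'') (V ''m'')) (IAdd (V ''n'') (IConst 1)))
           (BAnd (BNot (RLess (RCell ''k'' (IConst 0)) (RCell ''f'' (V ''q''))))
             (BNot (BAnd (BNot (ILess (V ''found'') (IConst 1)))
               (BNot (RLess cand (RCell ''best'' (IConst 0)))))))) s' \<longleftrightarrow>
         i + m \<le> n \<and> f_of s i \<le> k \<and> \<not> solved s' R"
      by (auto simp: x env_vars[OF e'] solved_def f_of_def same)
    show "wlp c (?I (Suc i)) s'"
    proof (cases "i + m \<le> n \<and> f_of s i \<le> k \<and> \<not> solved s' R")
      case False
      then show ?thesis unfolding c_def wlp_If guard using I by (auto simp: less_Suc_eq)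
    next
      case True
      define s1 where "s1 = rupd ''best'' 0 R (iupd ''found'' 0 1 s')"
      have ag1: "agree {''found''} {''best''} s' s1" by (auto simp: s1_def agree_def iupd_def rupd_def)
      have e1: "env R s1" by (rule env_agree[OF ag1 _ _ e']) auto
      have q1: "ints s1 ''q'' 0 = int i" using x by (simp add: s1_def)
      have "wlp save_set (?I (Suc i)) s1"
      proof (rule wlp_mono[OF wlp_save_set[OF e1 q1]])
        fix s2 assume ag2: "agree (int_writes save_set) (real_writes save_set) s1 s2"
          and out: "output_set n s2 = sel_of s1 i"
        have fb: "ints s2 ''found'' 0 = 1" "reals s2 ''best'' 0 = R"
          using agree_int[OF ag2, of "''found''"] agree_real[OF ag2, of "''best''"] by (simp_all add: s1_def)
        have "sel_of s1 i = sel_of s i" by (simp add: s1_def sel_of_def same)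
        then have out: "output_set n s2 = sel_of s i" using out by simp
        have snd: "sel_of s i \<subseteq> {..<n}" "sum w (sel_of s i) \<le> f_of s i"
          "n \<le> i + card ({..<n} \<inter> covered (3 * R) (sel_of s i))"
          using sound True i by (auto simp: knapsack_sound_def)
        have "{..<n} \<inter> covered (3 * R) (sel_of s i) = covered (3 * R) (sel_of s i)"
          by (auto simp: covered_def)
        then have "output_ok s2"
          using snd True by (auto simp: output_ok_def out fb rkc_feasible_def)
        moreover have "solved s2 x" if "solved s x" for x
        proof -
          \<comment> \<open>A solution being overwritten had \<open>best\<close> above
            \<open>R\<close>, as \<open>solved s' R\<close> failed; hence \<open>R\<close> is at
            most \<open>x\<close> too.\<close>
          have "solved s' x" using I that by blast
          then show ?thesis using True by (auto simp: solved_def fb)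
        qed
        moreover have "solved s2 R" by (simp add: solved_def fb)
        ultimately show "?I (Suc i) s2" by blast
      qed (use i in simp)
      then show ?thesis
        unfolding c_def wlp_If guard using True env_vars(9)[OF e'] by (simp add: s1_def)
    qed
  qed (use env_vars[OF e] ok in \<open>auto simp: output_ok_def output_set_def solved_def\<close>)
  then show ?thesis .
qed

text \<open>Clustering updates \<open>y\<close> whether or not the knapsack succeeds, so the norm
  bound holds in either case; the gain is what a failed knapsack guarantees.\<close>

lemma wlp_perceptron_step:
  assumes e: "env R s" and ok: "output_ok s"
  shows "wlp (Seq init_table (Seq greedy record_best)) (\<lambda>s'. output_ok s' \<and>
    (\<forall>x. solved s x \<longrightarrow> solved s' x) \<and>
    (0 < m \<longrightarrow> solved s' R \<or> (\<Sum>v<n. (y_of s' v)\<^sup>2) \<le> (\<Sum>v<n. (y_of s v)\<^sup>2) + (int n)\<^sup>2 \<and>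
      (\<forall>S. rkc_feasible {..<n} w k S \<longrightarrow> m \<le> card (covered R S) \<longrightarrow>
        (\<Sum>v\<in>covered R S. y_of s v) + 1 \<le> (\<Sum>v\<in>covered R S. y_of s' v)))) s"
    (is "wlp _ ?Q s")
  unfolding wlp_Seq
proof (rule wlp_mono[OF wlp_init_table[OF e]], elim conjE)
  fix s1 assume ag1: "agree (int_writes init_table) (real_writes init_table) s s1"
    and s1: "cov_is s1 {}" "f_of s1 n = 0" "\<forall>q<n. f_of s1 q = k + 1" "sel_of s1 n = {}"
  have e1: "env R s1" by (rule env_agree[OF ag1 _ _ e]) auto
  have y1: "y_of s1 = y_of s" using ag1 by (auto simp: agree_def y_of_def fun_eq_iff)
  have "greedy_state R (y_of s) {} (\<lambda>_. 0) s1"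
    using s1 clustering_empty knapsack_sound_init[of "f_of s1" "sel_of s1"] knapsack_complete_init
    by (simp add: greedy_state_def y1)
  note greedy = wlp_greedy[OF e1 this]
  show "wlp greedy (wlp record_best ?Q) s1"
  proof (rule wlp_mono[OF greedy], elim exE)
    fix s2 \<alpha> assume ag2: "agree (int_writes greedy) (real_writes greedy) s1 s2"
      and g: "greedy_state R (y_of s) {..<n} \<alpha> s2"
    have e2: "env R s2" by (rule env_agree[OF ag2 _ _ e1]) auto
    have same: "ints s2 ''S'' = ints s ''S''" "ints s2 ''found'' = ints s ''found''" "reals s2 ''best'' = reals s ''best''"
      using ag1 ag2 by (auto simp: agree_def)
    have ok2: "output_ok s2" using ok by (simp add: output_ok_def output_set_def same)
    have sound: "knapsack_sound R {..<n} (f_of s2) (sel_of s2)" using g by (simp add: greedy_state_def)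
    have cl: "clustering R (y_of s) {..<n} \<alpha>" and cp: "knapsack_complete R \<alpha> (f_of s2)"
      using g by (auto simp: greedy_state_def)
    have y2: "y_of s2 v = y_of s v + 1 - int (\<alpha> v)" if "v < n" for v
      using g that by (simp add: greedy_state_def)
    show "wlp record_best ?Q s2"
    proof (rule wlp_mono[OF wlp_record_best[OF e2 ok2 sound]], elim conjE)
      fix s3 assume ag3: "agree (int_writes record_best) (real_writes record_best) s2 s3"
        and s3: "output_ok s3" "\<forall>x. solved s2 x \<longrightarrow> solved s3 x"
          "(\<exists>q<n. q + m \<le> n \<and> f_of s2 q \<le> k) \<longrightarrow> solved s3 R"
      have y3: "y_of s3 v = y_of s v + 1 - int (\<alpha> v)" if "v < n" for v
        using agree_int[OF ag3, of "''y''"] y2[OF that] by (simp add: y_of_def)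
      have "(\<Sum>v<n. (y_of s3 v)\<^sup>2) = (\<Sum>v<n. (y_of s v + 1 - int (\<alpha> v))\<^sup>2)"
        using y3 by simp
      then have norm: "(\<Sum>v<n. (y_of s3 v)\<^sup>2) \<le> (\<Sum>v<n. (y_of s v)\<^sup>2) + (int n)\<^sup>2"
        using perceptron_norm[OF cl] by simp
      have gain: "(\<Sum>v\<in>covered R S. y_of s v) + 1 \<le> (\<Sum>v\<in>covered R S. y_of s3 v)"
        if "0 < m" "\<not> solved s3 R" "rkc_feasible {..<n} w k S" "m \<le> card (covered R S)" for S
      proof -
        have "(\<Sum>v\<in>covered R S. y_of s3 v) = (\<Sum>v\<in>covered R S. y_of s v + 1 - int (\<alpha> v))"
          by (intro sum.cong y3) (auto simp: covered_def)
        \<comment> \<open>Contrapositive of the recording step: had an entry of sufficient profit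
          fit the budget, radius \<open>R\<close> would be solved.\<close>
        moreover have "k < f_of s2 q" if "q < n" "q + m \<le> n" for q
          using s3(3) \<open>\<not> solved s3 R\<close> that by (meson not_less)
        ultimately show ?thesis using perceptron_gain[OF cl cp _ that(1,3,4)] by simp
      qed
      have "solved s2 x \<longleftrightarrow> solved s x" for x by (simp add: solved_def same)
      then have "\<forall>x. solved s x \<longrightarrow> solved s3 x" using s3(2) by blast
      then show "?Q s3" using s3(1) norm gain by blast
    qed
  qed
qed

text \<open>While radius \<open>R\<close> is unsolved, \<open>t\<close> rounds leave the squared
  norm at most \<open>t * n ^ 2\<close> and the sum of \<open>y\<close> over the points covered by
  any solution of radius \<open>R\<close> at least \<open>t\<close>. At \<open>t = n ^ 3 + 1\<close>
  this contradicts \<open>perceptron_terminates\<close> if such a solution exists.\<close>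

lemma wlp_perceptron:
  assumes e: "env R s" and ok: "output_ok s"
  shows "wlp perceptron (\<lambda>s'. output_ok s' \<and> (\<forall>x. solved s x \<longrightarrow> solved s' x) \<and>
    (\<forall>S. 0 < m \<longrightarrow> rkc_feasible {..<n} w k S \<longrightarrow> m \<le> card (covered R S) \<longrightarrow> solved s' R)) s"
    (is "wlp _ ?Q s")
proof -
  let ?J = "\<lambda>i s'. \<forall>v<i. y_of s' v = 0"
  have zero: "wlp (For ''v'' ''n'' (IAssign ''y'' (V ''v'') (IConst 0))) (?J n) s"
    by (rule wlp_For[where Inv = ?J and N = n])
      (use env_vars[OF e] in \<open>auto simp: y_of_def less_Suc_eq\<close>)
  define c where "c = Seq init_table (Seq greedy record_best)"
  have wc: "int_writes c = {''j'', ''r'', ''a'', ''b'', ''v'', ''cov'', ''y'', ''q'', ''u'', ''sel'', ''found'', ''S''}"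
    "real_writes c = {''f'', ''best''}" by (auto simp: c_def)
  let ?C = "\<lambda>S. rkc_feasible {..<n} w k S \<and> m \<le> card (covered R S)"
  let ?I = "\<lambda>t s'. output_ok s' \<and> (\<forall>x. solved s x \<longrightarrow> solved s' x) \<and>
    (0 < m \<longrightarrow> solved s' R \<or> (\<Sum>v<n. (y_of s' v)\<^sup>2) \<le> int t * (int n)\<^sup>2 \<and>
      (\<forall>S. ?C S \<longrightarrow> int t \<le> (\<Sum>v\<in>covered R S. y_of s' v)))"
  show ?thesis
    unfolding perceptron_def c_def[symmetric] wlp_Seq
  proof (rule wlp_mono[OF zero])
    fix s1 assume ag1: "agree (int_writes (For ''v'' ''n'' (IAssign ''y'' (V ''v'') (IConst 0))))
        (real_writes (For ''v'' ''n'' (IAssign ''y'' (V ''v'') (IConst 0)))) s s1"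
      and y1: "\<forall>v<n. y_of s1 v = 0"
    have e1: "env R s1" by (rule env_agree[OF ag1 _ _ e]) auto
    have same: "ints s1 ''S'' = ints s ''S''" "ints s1 ''found'' = ints s ''found''" "reals s1 ''best'' = reals s ''best''"
      using ag1 by (auto simp: agree_def)
    have "wlp (For ''it'' ''N'' c) (?I (n ^ 3 + 1)) s1"
    proof (rule wlp_For[where Inv = ?I and N = "n ^ 3 + 1"], unfold wc)
      have "(\<Sum>v\<in>covered R S. y_of s1 v) = 0" for S
        using y1 by (intro sum.neutral) (auto simp: covered_def)
      then show "?I 0 s1" using ok y1 by (simp add: output_ok_def output_set_def solved_def same)
      show "ints s1 ''N'' 0 = int (n ^ 3 + 1)" using env_vars[OF e1] by simp
      fix t s' z assume I: "?I t s'"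
      have "output_ok (iupd ''it'' 0 z s') = output_ok s'" "solved (iupd ''it'' 0 z s') = solved s'"
        "y_of (iupd ''it'' 0 z s') = y_of s'"
        by (simp_all add: output_ok_def output_set_def solved_def y_of_def fun_eq_iff)
      with I show "?I t (iupd ''it'' 0 z s')" by presburger
    next
      fix t s'
      assume I: "?I t s'" and
        ag: "agree {''it'', ''j'', ''r'', ''a'', ''b'', ''v'', ''cov'', ''y'', ''q'', ''u'', ''sel'', ''found'', ''S''}
          {''f'', ''best''} s1 s'"
      have e': "env R s'" by (rule env_agree[OF ag _ _ e1]) auto
      have ok': "output_ok s'" using I by blast
      show "wlp c (?I (Suc t)) s'"
        unfolding c_def
      proof (rule wlp_mono[OF wlp_perceptron_step[OF e' ok']], elim conjE)
        fix s2 assume s2: "output_ok s2" "\<forall>x. solved s' x \<longrightarrow> solved s2 x"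
          and st: "0 < m \<longrightarrow> solved s2 R \<or> (\<Sum>v<n. (y_of s2 v)\<^sup>2) \<le> (\<Sum>v<n. (y_of s' v)\<^sup>2) + (int n)\<^sup>2 \<and>
            (\<forall>S. rkc_feasible {..<n} w k S \<longrightarrow> m \<le> card (covered R S) \<longrightarrow>
              (\<Sum>v\<in>covered R S. y_of s' v) + 1 \<le> (\<Sum>v\<in>covered R S. y_of s2 v))"
        have "(\<Sum>v<n. (y_of s2 v)\<^sup>2) \<le> int (Suc t) * (int n)\<^sup>2 \<and>
            (\<forall>S. ?C S \<longrightarrow> int (Suc t) \<le> (\<Sum>v\<in>covered R S. y_of s2 v))" if m: "0 < m" and no: "\<not> solved s2 R"
        proof (intro conjI allI impI)
          have "\<not> solved s' R" using no s2 by blast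
          then have old: "(\<Sum>v<n. (y_of s' v)\<^sup>2) \<le> int t * (int n)\<^sup>2"
            "\<And>S. ?C S \<Longrightarrow> int t \<le> (\<Sum>v\<in>covered R S. y_of s' v)" using I m by blast+
          show "(\<Sum>v<n. (y_of s2 v)\<^sup>2) \<le> int (Suc t) * (int n)\<^sup>2"
            using old(1) st m no by (simp add: algebra_simps)
          fix S assume "?C S"
          then show "int (Suc t) \<le> (\<Sum>v\<in>covered R S. y_of s2 v)"
            using old(2)[of S] st m no by fastforce
        qed
        then show "?I (Suc t) s2" using s2 I by blast
      qed
    qed auto
    then show "wlp (For ''it'' ''N'' c) ?Q s1"
    proof (rule wlp_mono)
      fix s' assume I: "?I (n ^ 3 + 1) s'"
      have "solved s' R" if "0 < m" "?C S" for S
      proof (rule ccontr)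
        assume "\<not> solved s' R"
        then have y: "(\<Sum>v<n. (y_of s' v)\<^sup>2) \<le> int (n ^ 3 + 1) * (int n)\<^sup>2"
          "int (n ^ 3 + 1) \<le> (\<Sum>v\<in>covered R S. y_of s' v)" using I that by blast+
        have "covered R S \<subseteq> {..<n}" by (auto simp: covered_def)
        from perceptron_terminates[OF this y(2,1)] show False by simp
      qed
      then show "?Q s'" using I by blast
    qed
  qed
qed

section \<open>Search over all candidate radii\<close>

text \<open>Unlike in \<open>env_agree\<close>, \<open>e\<close> may have moved here; position
  \<open>i\<close> of the matrix stored by rows supplies the new radius.\<close>

lemma env_candidate:
  assumes e: "env R s" and ag: "agree I J s s'" "I \<inter> {''n'', ''m'', ''row'', ''nn'', ''N''} = {}"
    "J \<inter> {''d'', ''w'', ''k''} = {}" and i: "ints s' ''e'' 0 = int i" "i < n * n"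
  shows "env (d (i div n) (i mod n)) s'"
proof -
  have ints: "ints s' a = ints s a" if "a \<in> {''n'', ''m'', ''row'', ''nn'', ''N''}" for a
    using ag that by (intro agree_int) auto
  have reals: "reals s' a = reals s a" if "a \<in> {''d'', ''w'', ''k''}" for a
    using ag that by (intro agree_real) auto
  have "i div n < n" "i mod n < n"
    using i by (cases "n = 0"; simp add: less_mult_imp_div_less)+
  then have "reals s ''d'' (int (i div n) * int n + int (i mod n)) = d (i div n) (i mod n)"
    by (rule env_vars(6)[OF e])
  moreover have "int (i div n) * int n + int (i mod n) = int i"
    by (metis div_mult_mod_eq of_nat_add of_nat_mult)
  ultimately have "reals s ''d'' (int i) = d (i div n) (i mod n)" by simp
  then show ?thesis using e ints reals i d_nonneg unfolding env_def by simp
qed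

text \<open>Every candidate radius that admits a solution ends up solved, so the final
  \<open>best\<close> is at most each of them, and covering within \<open>3 * best\<close> implies
  covering within three times the candidate.\<close>

lemma wlp_search:
  assumes e: "env R s" and ok: "output_ok s"
  shows "wlp search (\<lambda>s'. rkc_approx 3 {..<n} d w k m (output_set n s')) s"
proof -
  let ?I = "\<lambda>i s'. output_ok s' \<and> (\<forall>j<i. \<forall>S. 0 < m \<longrightarrow> rkc_feasible {..<n} w k S \<longrightarrow>
    m \<le> card (covered (d (j div n) (j mod n)) S) \<longrightarrow> solved s' (d (j div n) (j mod n)))"
  have "wlp search (?I (n * n)) s"
    unfolding search_def
  proof (rule wlp_For[where Inv = ?I and N = "n * n"])
    fix i s' assume i: "i < n * n" "ints s' ''e'' 0 = int i" and I: "?I i s'"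
      and ag: "agree (insert ''e'' (int_writes perceptron)) (real_writes perceptron) s s'"
    have e': "env (d (i div n) (i mod n)) s'"
      by (rule env_candidate[OF e ag _ _ i(2,1)]) auto
    have ok': "output_ok s'" using I by blast
    show "wlp perceptron (?I (Suc i)) s'"
      by (rule wlp_mono[OF wlp_perceptron[OF e' ok']]) (use I in \<open>auto simp: less_Suc_eq\<close>)
  qed (use env_vars[OF e] ok in \<open>auto simp: output_ok_def output_set_def solved_def\<close>)
  then show ?thesis
  proof (rule wlp_mono)
    fix s' assume I: "?I (n * n) s'"
    show "rkc_approx 3 {..<n} d w k m (output_set n s')"
    proof (rule approx_of_covered)
      show "rkc_feasible {..<n} w k (output_set n s')" using I by (simp add: output_ok_def)
      fix i j S assume S: "0 < m" "i < n" "j < n" "rkc_feasible {..<n} w k S" "m \<le> card (covered (d i j) S)"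
      \<comment> \<open>The distance \<open>d i j\<close> is the candidate at position
        \<open>i * n + j\<close>.\<close>
      have "i * n + j < (i + 1) * n" using S by simp
      also have "\<dots> \<le> n * n" using S by (intro mult_right_mono) auto
      finally have "i * n + j < n * n" .
      moreover have "(i * n + j) div n = i" "(i * n + j) mod n = j" using S by auto
      ultimately have "solved s' (d i j)" using I S by metis
      then have "m \<le> card (covered (3 * reals s' ''best'' 0) (output_set n s'))"
        "reals s' ''best'' 0 \<le> d i j" using I by (auto simp: output_ok_def solved_def)
      then show "m \<le> card (covered (3 * d i j) (output_set n s'))"
        using card_mono[OF finite_covered covered_mono[of "3 * reals s' ''best'' 0" "3 * d i j", OF _ subset_refl]]
        by (meson le_trans mult_le_cancel_left_pos zero_less_numeral)
    qed
  qed
qed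

section \<open>Tabulated products and loop bounds\<close>

lemma wlp_prelude:
  defines "s \<equiv> rkc_input n d w k m"
  shows "wlp prelude (\<lambda>s'. env (reals s ''d'' 0) s' \<and> output_ok s') s"
proof -
  let ?I = "\<lambda>i s'. \<forall>j\<le>i. ints s' ''row'' (int j) = int j * int n"
  define c where "c = IAssign ''row'' (IAdd (V ''v'') (IConst 1)) (IAdd (ICell ''row'' (V ''v'')) (V ''n''))"
  have row: "wlp (For ''v'' ''n'' c) (?I n) s"
  proof (rule wlp_For[where Inv = ?I and N = n])
    fix i s' assume I: "?I i s'" and x: "ints s' ''v'' 0 = int i" and
      ag: "agree (insert ''v'' (int_writes c)) (real_writes c) s s'"
    have "ints s' ''n'' = ints s ''n''" using ag by (simp add: agree_def c_def)
    then have "ints s' ''n'' 0 = int n" by (simp add: s_def rkc_input_def)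
    then show "wlp c (?I (Suc i)) s'" using I by (auto simp: c_def x le_Suc_eq algebra_simps)
  qed (auto simp: s_def rkc_input_def c_def)
  \<comment> \<open>Starting from 1, each of the \<open>n\<close> rounds adds \<open>n * n\<close>,
    which ends at \<open>n ^ 3 + 1\<close>.\<close>
  let ?J = "\<lambda>i s'. ints s' ''N'' 0 = int (i * (n * n) + 1)"
  let ?c = "assign ''N'' (IAdd (V ''N'') (V ''nn''))"
  show ?thesis
    unfolding prelude_def wlp_Seq c_def[symmetric]
  proof (rule wlp_mono[OF row])
    fix s1 assume ag1: "agree (int_writes (For ''v'' ''n'' c)) (real_writes (For ''v'' ''n'' c)) s s1" and I: "?I n s1"
    have n1: "ints s1 ''n'' 0 = int n"
      using agree_int[OF ag1, of "''n''"] by (simp add: c_def s_def rkc_input_def)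
    define s2 where "s2 = iupd ''N'' 0 1 (iupd ''nn'' 0 (int n * int n) s1)"
    have "wlp (For ''v'' ''n'' ?c) (?J n) s2"
    proof (rule wlp_For[where Inv = ?J and N = n])
      fix i s' assume J: "?J i s'" and ag: "agree (insert ''v'' (int_writes ?c)) (real_writes ?c) s2 s'"
      have "ints s' ''nn'' 0 = int n * int n"
        using agree_int[OF ag, of "''nn''"] by (simp add: s2_def)
      then show "wlp ?c (?J (Suc i)) s'" using J by simp
    qed (use n1 in \<open>auto simp: s2_def\<close>)
    then have "wlp (For ''v'' ''n'' ?c) (\<lambda>s'. env (reals s ''d'' 0) s' \<and> output_ok s') s2"
    proof (rule wlp_mono)
      fix s' assume J: "?J n s'"
        and ag: "agree (int_writes (For ''v'' ''n'' ?c)) (real_writes (For ''v'' ''n'' ?c)) s2 s'"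
      have ints': "ints s' a = ints s2 a" if "a \<notin> {''v'', ''N''}" for a
        using agree_int[OF ag] that by simp
      have ints: "ints s' a = ints s a" if "a \<notin> {''v'', ''N'', ''nn'', ''row''}" for a
        using agree_int[OF ag1, of a] ints'[of a] that by (simp add: s2_def c_def fun_eq_iff)
      have reals: "reals s' = reals s"
        using ag ag1 by (auto simp: agree_def s2_def c_def)
      have "int i * int n + int j < int n * int n" if "i < n" "j < n" for i j
      proof -
        have "i * n + j < (i + 1) * n" using that by simp
        also have "\<dots> \<le> n * n" using that by (intro mult_right_mono) auto
        finally show ?thesis by (simp only: of_nat_less_iff flip: of_nat_mult of_nat_add)
      qed
      moreover have "nat (int i * int n + int j) = i * n + j" for i j
        by (simp add: nat_int_add flip: of_nat_mult)
      ultimately have "\<forall>i<n. \<forall>j<n. reals s ''d'' (int i * int n + int j) = d i j"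
        by (simp add: s_def rkc_input_def)
      \<comment> \<open>For \<open>n = 0\<close> this cell lies outside the matrix and holds the
        default 0.\<close>
      moreover have "0 \<le> reals s ''d'' 0" using d_nonneg by (simp add: s_def rkc_input_def)
      moreover have "ints s' ''n'' 0 = int n" "ints s' ''m'' 0 = int m" "ints s' ''e'' 0 = 0"
        "ints s' ''S'' = (\<lambda>_. 0)" "ints s' ''found'' 0 = 0"
        by (simp_all add: ints) (simp_all add: s_def rkc_input_def)
      moreover have "ints s' ''nn'' 0 = int n * int n" "ints s' ''row'' = ints s1 ''row''"
        by (simp_all add: ints' s2_def fun_eq_iff)
      ultimately show "env (reals s ''d'' 0) s' \<and> output_ok s'"
        using I J k_nonneg
        by (simp add: env_def output_ok_def output_set_def rkc_feasible_def reals power3_eq_cube)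
          (simp add: s_def rkc_input_def)
    qed
    moreover have "ints s1 ''row'' (int n) = int n * int n" using I by simp
    ultimately show "wlp (assign ''nn'' (ICell ''row'' (V ''n''))) (wlp (assign ''N'' (IConst 1))
        (wlp (For ''v'' ''n'' ?c) (\<lambda>s'. env (reals s ''d'' 0) s' \<and> output_ok s'))) s1"
      by (simp add: s2_def n1)
  qed
qed

end

section \<open>Running time and approximation guarantee combined\<close>

theorem theorem3:
  "\<exists>(prog :: com) (p :: nat poly).
     \<forall>(n :: nat) (d :: nat \<Rightarrow> nat \<Rightarrow> real) (w :: nat \<Rightarrow> real) (k :: real) (m :: nat).
       rkc_instance {..<n} d w k m \<longrightarrow>
       (\<exists>t s. exec prog (rkc_input n d w k m) t s \<and>
              t \<le> poly p n \<and>
              rkc_approx 3 {..<n} d w k m (output_set n s))"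
proof -
  \<comment> \<open>\<open>N1\<close> bounds the prelude loops, which run up to \<open>n\<close>;
    \<open>N2\<close> dominates the bounds \<open>n\<close>, \<open>n * n\<close> and
    \<open>n ^ 3 + 1\<close> of \<open>search\<close>.\<close>
  define N1 N2 :: "nat poly" where "N1 = [:0, 1:]" and "N2 = [:0, 1:] ^ 3 + 1"
  have N: "poly N1 n = n" "poly N2 n = n ^ 3 + 1" for n by (simp_all add: N1_def N2_def)
  obtain p1 :: "nat poly" where p1: "\<And>n (s :: state). ints s ''n'' 0 \<le> int n \<Longrightarrow>
      \<exists>t s'. exec prelude s t s' \<and> t \<le> poly p1 n"
    using poly_time_prelude[of N1] by (auto simp: poly_time_def N)
  obtain p2 :: "nat poly" where p2: "\<And>n (s :: state). \<forall>b\<in>{''n'', ''nn'', ''N''}. ints s b 0 \<le> int (n ^ 3 + 1) \<Longrightarrow>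
      \<exists>t s'. exec search s t s' \<and> t \<le> poly p2 n"
    using poly_time_search[of N2] unfolding poly_time_def N by metis
  show ?thesis
  proof (intro exI[of _ "Seq prelude search"] exI[of _ "p1 + p2"] allI impI)
    fix n m :: nat and d :: "nat \<Rightarrow> nat \<Rightarrow> real" and w :: "nat \<Rightarrow> real" and k :: real
    assume "rkc_instance {..<n} d w k m"
    then interpret rkc n d w k m by unfold_locales
    let ?s = "rkc_input n d w k m"
    have "ints ?s ''n'' 0 \<le> int n" by (simp add: rkc_input_def)
    then obtain t1 s1 where 1: "exec prelude ?s t1 s1" "t1 \<le> poly p1 n" using p1 by blast
    then have s1: "env (reals ?s ''d'' 0) s1" "output_ok s1"
      using wlp_prelude unfolding wlp_def by blast+
    have "n \<le> n ^ 3" "n * n \<le> n ^ 3" by (cases "n = 0"; simp add: power3_eq_cube)+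
    then have "\<forall>b\<in>{''n'', ''nn'', ''N''}. ints s1 b 0 \<le> int (n ^ 3 + 1)"
      using env_vars[OF s1(1)] by (simp flip: of_nat_mult of_nat_power)
    then obtain t2 s2 where 2: "exec search s1 t2 s2" "t2 \<le> poly p2 n" using p2 by blast
    have "rkc_approx 3 {..<n} d w k m (output_set n s2)"
      using wlp_search[OF s1] 2 unfolding wlp_def by blast
    moreover have "t1 + t2 \<le> poly (p1 + p2) n" using 1 2 by simp
    ultimately show "\<exists>t s. exec (Seq prelude search) ?s t s \<and> t \<le> poly (p1 + p2) n \<and>
        rkc_approx 3 {..<n} d w k m (output_set n s)"
      using exec.Seq[OF 1(1) 2(1)] by blast
  qed
qed

end
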